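(* Let $C$ and $D$ be coalgebras over a field $k$, let $\Psi: C\otimes D\to D\otimes C$ be a twist map satisfying the coassociativity condition, and suppose that $\Delta_\Psi$ admits a counit $\varepsilon_\Psi$, so that $C\otimes_\Psi D=(C\otimes D,\Delta_\Psi,\varepsilon_\Psi)$ is a coalgebra. Let $p_C: C\otimes_\Psi D\to C$, $p_C(c\otimes d)=c_{(1)}\,\varepsilon_\Psi(c_{(2)}\otimes d)$, and $p_D: C\otimes_\Psi D\to D$, $p_D(c\otimes d)=\varepsilon_\Psi(c\otimes d_{(1)})\,d_{(2)}$. Let $Y$ be a coassociative coalgebra together with coalgebra morphisms $u_C: Y\to C$ and $u_D: Y\to D$ such that $$(u_D\otimes u_C)\circ\Delta_Y=\Psi\circ(u_C\otimes u_D)\circ\Delta_Y,\qquad \varepsilon_\Psi\circ(u_C\otimes u_D)\circ\Delta_Y=\varepsilon_Y .$$ Then there exists a coalgebra morphism $\omega: Y\to C\otimes_\Psi D$ such that $u_C=p_C\circ\omega$ and $u_D=p_D\circ\omega$.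
   Context: All coalgebras are coassociative and counital over the field $k$; $\Delta_C,\varepsilon_C$ denote the coproduct and counit of $C$, and Sweedler notation $\Delta(c)=c_{(1)}\otimes c_{(2)}$ is used. A twist map is a $k$-linear map $\Psi: C\otimes D\to D\otimes C$. The twisted coproduct on $C\otimes D$ is $\Delta_\Psi:=(\mathrm{id}_C\otimes\Psi\otimes\mathrm{id}_D)\circ(\Delta_C\otimes\Delta_D)$. The coassociativity condition on $\Psi$ is $$(\mathrm{id}_D\otimes\mathrm{id}_C\otimes\Psi)(\mathrm{id}_D\otimes\Delta_C\otimes\mathrm{id}_D)(\Psi\otimes\mathrm{id}_D)(\mathrm{id}_C\otimes\Delta_D)=(\Psi\otimes\mathrm{id}_D\otimes\mathrm{id}_C)(\mathrm{id}_C\otimes\Delta_D\otimes\mathrm{id}_C)(\mathrm{id}_C\otimes\Psi)(\Delta_C\otimes\mathrm{id}_D);$$ it is equivalent to coassociativity of $\Delta_\Psi$. A counit for $\Delta_\Psi$ is a linear functional $\varepsilon_\Psi: C\otimes D\to k$ with $(\varepsilon_\Psi\otimes\mathrm{id})\Delta_\Psi=\mathrm{id}_{C\otimes D}=(\mathrm{id}\otimes\varepsilon_\Psi)\Delta_\Psi$. *)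

theory Defs
  imports "Jordan_Normal_Form.Missing_VectorSpace" "HOL-Algebra.AbelCoset"
begin

section \<open>Tensor products of vector spaces\<close>

text \<open>
  Vector spaces are carrier based (\<^locale>\<open>vectorspace\<close>, \<^locale>\<open>linear_map\<close>).  The tensor
  product is the free vector space on the cartesian product of the carriers modulo the span of the
  bilinearity relations; its elements are therefore cosets of finitely supported functions.
  Functions are only meaningful on carriers, so all identities between maps are stated pointwise
  on the carrier of the source.
\<close>

definition scalar_space :: "('k, 'r) ring_scheme \<Rightarrow> ('k, 'k) module" where
  "scalar_space K =
    \<lparr>carrier = carrier K, mult = mult K, one = one K, zero = zero K, add = add K, smult = mult K\<rparr>"

definition free_space :: "('k, 'r) ring_scheme \<Rightarrow> 's set \<Rightarrow> ('k, 's \<Rightarrow> 'k) module" where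
  "free_space K S = (ring.func_space K S)
    \<lparr>carrier := {\<phi> \<in> S \<rightarrow>\<^sub>E carrier K. finite {s \<in> S. \<phi> s \<noteq> \<zero>\<^bsub>K\<^esub>}}\<rparr>"

definition free_gen :: "('k, 'r) ring_scheme \<Rightarrow> 's set \<Rightarrow> 's \<Rightarrow> 's \<Rightarrow> 'k" where
  "free_gen K S s = (\<lambda>t\<in>S. if t = s then \<one>\<^bsub>K\<^esub> else \<zero>\<^bsub>K\<^esub>)"

definition quotient_space :: "('k, 'v, 'x) module_scheme \<Rightarrow> 'v set \<Rightarrow> ('k, 'v set) module" where
  "quotient_space V W =
    \<lparr>carrier = a_rcosets\<^bsub>V\<^esub> W, mult = undefined, one = undefined, zero = W, add = set_add V,
     smult = (\<lambda>a X. \<Union>x\<in>X. W +>\<^bsub>V\<^esub> (a \<odot>\<^bsub>V\<^esub> x))\<rparr>"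

definition tensor_relations ::
  "('k, 'r) ring_scheme \<Rightarrow> ('k, 'm, 'x) module_scheme \<Rightarrow> ('k, 'n, 'y) module_scheme
    \<Rightarrow> ('m \<times> 'n \<Rightarrow> 'k) set" where
  "tensor_relations K M N =
    (let F = free_space K (carrier M \<times> carrier N);
         g = (\<lambda>m n. free_gen K (carrier M \<times> carrier N) (m, n))
     in {g (m \<oplus>\<^bsub>M\<^esub> m') n \<ominus>\<^bsub>F\<^esub> (g m n \<oplus>\<^bsub>F\<^esub> g m' n) | m m' n.
           m \<in> carrier M \<and> m' \<in> carrier M \<and> n \<in> carrier N}
      \<union> {g m (n \<oplus>\<^bsub>N\<^esub> n') \<ominus>\<^bsub>F\<^esub> (g m n \<oplus>\<^bsub>F\<^esub> g m n') | m n n'.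
           m \<in> carrier M \<and> n \<in> carrier N \<and> n' \<in> carrier N}
      \<union> {g (a \<odot>\<^bsub>M\<^esub> m) n \<ominus>\<^bsub>F\<^esub> (a \<odot>\<^bsub>F\<^esub> g m n) | a m n.
           a \<in> carrier K \<and> m \<in> carrier M \<and> n \<in> carrier N}
      \<union> {g m (a \<odot>\<^bsub>N\<^esub> n) \<ominus>\<^bsub>F\<^esub> (a \<odot>\<^bsub>F\<^esub> g m n) | a m n.
           a \<in> carrier K \<and> m \<in> carrier M \<and> n \<in> carrier N})"

definition tensor_null ::
  "('k, 'r) ring_scheme \<Rightarrow> ('k, 'm, 'x) module_scheme \<Rightarrow> ('k, 'n, 'y) module_scheme
    \<Rightarrow> ('m \<times> 'n \<Rightarrow> 'k) set" where
  "tensor_null K M N =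
    module.span K (free_space K (carrier M \<times> carrier N)) (tensor_relations K M N)"

definition tensor_space ::
  "('k, 'r) ring_scheme \<Rightarrow> ('k, 'm, 'x) module_scheme \<Rightarrow> ('k, 'n, 'y) module_scheme
    \<Rightarrow> ('k, ('m \<times> 'n \<Rightarrow> 'k) set) module"  (infixl \<open>\<boxtimes>\<index>\<close> 70) where
  "M \<boxtimes>\<^bsub>K\<^esub> N = quotient_space (free_space K (carrier M \<times> carrier N)) (tensor_null K M N)"

definition pure_tensor ::
  "('k, 'r) ring_scheme \<Rightarrow> ('k, 'm, 'x) module_scheme \<Rightarrow> ('k, 'n, 'y) module_scheme
    \<Rightarrow> 'm \<Rightarrow> 'n \<Rightarrow> ('m \<times> 'n \<Rightarrow> 'k) set" where
  "pure_tensor K M N m n =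
    tensor_null K M N +>\<^bsub>free_space K (carrier M \<times> carrier N)\<^esub>
      free_gen K (carrier M \<times> carrier N) (m, n)"

text \<open>
  For bilinear \<open>f : M \<times> N \<rightarrow> P\<close>, the linear map \<open>M \<otimes> N \<rightarrow> P\<close> with \<open>m \<otimes> n \<mapsto> f m n\<close>: the linear
  extension of \<open>f\<close> to the free space is constant on each coset \<open>X\<close>, and \<^const>\<open>the_elem\<close> picks that
  common value.  In Sweedler notation, \<open>tensor_lift K C C P f (\<Delta> c)\<close> is \<open>f c\<^sub>(\<^sub>1\<^sub>) c\<^sub>(\<^sub>2\<^sub>)\<close>.
\<close>

definition tensor_lift ::
  "('k, 'r) ring_scheme \<Rightarrow> ('k, 'm, 'x) module_scheme \<Rightarrow> ('k, 'n, 'y) module_scheme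
    \<Rightarrow> ('k, 'p, 'z) module_scheme \<Rightarrow> ('m \<Rightarrow> 'n \<Rightarrow> 'p) \<Rightarrow> ('m \<times> 'n \<Rightarrow> 'k) set \<Rightarrow> 'p" where
  "tensor_lift K M N P f X = the_elem ((\<lambda>\<phi>.
     \<Oplus>\<^bsub>P\<^esub> s \<in> {s \<in> carrier M \<times> carrier N. \<phi> s \<noteq> \<zero>\<^bsub>K\<^esub>}. \<phi> s \<odot>\<^bsub>P\<^esub> f (fst s) (snd s)) ` X)"

text \<open>The map \<open>f \<otimes> g : M \<otimes> N \<rightarrow> M' \<otimes> N'\<close>.\<close>

definition tensor_map ::
  "('k, 'r) ring_scheme \<Rightarrow> ('k, 'm, 'x) module_scheme \<Rightarrow> ('k, 'n, 'y) module_scheme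
    \<Rightarrow> ('k, 'p, 'z) module_scheme \<Rightarrow> ('k, 'q, 'w) module_scheme
    \<Rightarrow> ('m \<Rightarrow> 'p) \<Rightarrow> ('n \<Rightarrow> 'q) \<Rightarrow> ('m \<times> 'n \<Rightarrow> 'k) set \<Rightarrow> ('p \<times> 'q \<Rightarrow> 'k) set" where
  "tensor_map K M N M' N' f g =
    tensor_lift K M N (M' \<boxtimes>\<^bsub>K\<^esub> N') (\<lambda>m n. pure_tensor K M' N' (f m) (g n))"

text \<open>The canonical isomorphisms \<open>(A \<otimes> B) \<otimes> C \<rightarrow> A \<otimes> (B \<otimes> C)\<close> and back, \<open>k \<otimes> M \<rightarrow> M\<close> and
  \<open>M \<otimes> k \<rightarrow> M\<close>, usually left implicit.\<close>

definition assoc_right ::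
  "('k, 'r) ring_scheme \<Rightarrow> ('k, 'a, 'x) module_scheme \<Rightarrow> ('k, 'b, 'y) module_scheme
    \<Rightarrow> ('k, 'c, 'z) module_scheme
    \<Rightarrow> (('a \<times> 'b \<Rightarrow> 'k) set \<times> 'c \<Rightarrow> 'k) set \<Rightarrow> ('a \<times> ('b \<times> 'c \<Rightarrow> 'k) set \<Rightarrow> 'k) set" where
  "assoc_right K A B C =
    tensor_lift K (A \<boxtimes>\<^bsub>K\<^esub> B) C (A \<boxtimes>\<^bsub>K\<^esub> (B \<boxtimes>\<^bsub>K\<^esub> C))
      (\<lambda>x c. tensor_lift K A B (A \<boxtimes>\<^bsub>K\<^esub> (B \<boxtimes>\<^bsub>K\<^esub> C))
        (\<lambda>a b. pure_tensor K A (B \<boxtimes>\<^bsub>K\<^esub> C) a (pure_tensor K B C b c)) x)"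

definition assoc_left ::
  "('k, 'r) ring_scheme \<Rightarrow> ('k, 'a, 'x) module_scheme \<Rightarrow> ('k, 'b, 'y) module_scheme
    \<Rightarrow> ('k, 'c, 'z) module_scheme
    \<Rightarrow> ('a \<times> ('b \<times> 'c \<Rightarrow> 'k) set \<Rightarrow> 'k) set \<Rightarrow> (('a \<times> 'b \<Rightarrow> 'k) set \<times> 'c \<Rightarrow> 'k) set" where
  "assoc_left K A B C =
    tensor_lift K A (B \<boxtimes>\<^bsub>K\<^esub> C) (A \<boxtimes>\<^bsub>K\<^esub> B \<boxtimes>\<^bsub>K\<^esub> C)
      (\<lambda>a x. tensor_lift K B C (A \<boxtimes>\<^bsub>K\<^esub> B \<boxtimes>\<^bsub>K\<^esub> C)
        (\<lambda>b c. pure_tensor K (A \<boxtimes>\<^bsub>K\<^esub> B) C (pure_tensor K A B a b) c) x)"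

definition unit_left ::
  "('k, 'r) ring_scheme \<Rightarrow> ('k, 'm, 'x) module_scheme \<Rightarrow> ('k \<times> 'm \<Rightarrow> 'k) set \<Rightarrow> 'm" where
  "unit_left K M = tensor_lift K (scalar_space K) M M (\<lambda>a m. a \<odot>\<^bsub>M\<^esub> m)"

definition unit_right ::
  "('k, 'r) ring_scheme \<Rightarrow> ('k, 'm, 'x) module_scheme \<Rightarrow> ('m \<times> 'k \<Rightarrow> 'k) set \<Rightarrow> 'm" where
  "unit_right K M = tensor_lift K M (scalar_space K) M (\<lambda>m a. a \<odot>\<^bsub>M\<^esub> m)"


section \<open>Coalgebras\<close>

definition coassociative ::
  "('k, 'r) ring_scheme \<Rightarrow> ('k, 'c, 'x) module_scheme \<Rightarrow> ('c \<Rightarrow> ('c \<times> 'c \<Rightarrow> 'k) set) \<Rightarrow> bool" where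
  "coassociative K C \<delta> \<longleftrightarrow> (\<forall>c\<in>carrier C.
     assoc_right K C C C (tensor_map K C C (C \<boxtimes>\<^bsub>K\<^esub> C) C \<delta> id (\<delta> c)) =
     tensor_map K C C C (C \<boxtimes>\<^bsub>K\<^esub> C) id \<delta> (\<delta> c))"

definition is_counit ::
  "('k, 'r) ring_scheme \<Rightarrow> ('k, 'c, 'x) module_scheme \<Rightarrow> ('c \<Rightarrow> ('c \<times> 'c \<Rightarrow> 'k) set)
    \<Rightarrow> ('c \<Rightarrow> 'k) \<Rightarrow> bool" where
  "is_counit K C \<delta> e \<longleftrightarrow> linear_map K C (scalar_space K) e \<and> (\<forall>c\<in>carrier C.
     unit_left K C (tensor_map K C C (scalar_space K) C e id (\<delta> c)) = c \<and>
     unit_right K C (tensor_map K C C C (scalar_space K) id e (\<delta> c)) = c)"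

record ('k, 'c) coalgebra = "('k, 'c) module" +
  comult :: "'c \<Rightarrow> ('c \<times> 'c \<Rightarrow> 'k) set"  (\<open>\<Delta>\<index>\<close>)
  counit :: "'c \<Rightarrow> 'k"  (\<open>\<epsilon>\<index>\<close>)

locale coalgebra = vectorspace K C
  for K :: "('k, 'r) ring_scheme" and C :: "('k, 'c, 'x) coalgebra_scheme" (structure) +
  assumes comult_linear: "linear_map K C (C \<boxtimes>\<^bsub>K\<^esub> C) \<Delta>"
    and comult_coassociative: "coassociative K C \<Delta>"
    and counit: "is_counit K C \<Delta> \<epsilon>"

definition coalgebra_hom ::
  "('k, 'r) ring_scheme \<Rightarrow> ('k, 'c, 'x) coalgebra_scheme \<Rightarrow> ('k, 'd, 'y) coalgebra_scheme
    \<Rightarrow> ('c \<Rightarrow> 'd) set" where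
  "coalgebra_hom K C D = {f. linear_map K C D f \<and> (\<forall>c\<in>carrier C.
     \<Delta>\<^bsub>D\<^esub> (f c) = tensor_map K C C D D f f (\<Delta>\<^bsub>C\<^esub> c) \<and> \<epsilon>\<^bsub>D\<^esub> (f c) = \<epsilon>\<^bsub>C\<^esub> c)}"


section \<open>Twisted tensor products of coalgebras\<close>

text \<open>\<open>(id \<otimes> \<Psi> \<otimes> id) \<circ> (\<Delta>\<^sub>C \<otimes> \<Delta>\<^sub>D)\<close>, with values in \<open>(C \<otimes> D) \<otimes> (C \<otimes> D)\<close>; the composition passes through
  \<open>C \<otimes> ((C \<otimes> D) \<otimes> D)\<close> and \<open>C \<otimes> ((D \<otimes> C) \<otimes> D)\<close>.\<close>

definition twisted_comult ::
  "('k, 'r) ring_scheme \<Rightarrow> ('k, 'c, 'x) coalgebra_scheme \<Rightarrow> ('k, 'd, 'y) coalgebra_scheme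
    \<Rightarrow> (('c \<times> 'd \<Rightarrow> 'k) set \<Rightarrow> ('d \<times> 'c \<Rightarrow> 'k) set)
    \<Rightarrow> ('c \<times> 'd \<Rightarrow> 'k) set \<Rightarrow> (('c \<times> 'd \<Rightarrow> 'k) set \<times> ('c \<times> 'd \<Rightarrow> 'k) set \<Rightarrow> 'k) set" where
  "twisted_comult K C D \<Psi> =
     assoc_left K C D (C \<boxtimes>\<^bsub>K\<^esub> D)
   \<circ> tensor_map K C (D \<boxtimes>\<^bsub>K\<^esub> C \<boxtimes>\<^bsub>K\<^esub> D) C (D \<boxtimes>\<^bsub>K\<^esub> (C \<boxtimes>\<^bsub>K\<^esub> D)) id (assoc_right K D C D)
   \<circ> tensor_map K C (C \<boxtimes>\<^bsub>K\<^esub> D \<boxtimes>\<^bsub>K\<^esub> D) C (D \<boxtimes>\<^bsub>K\<^esub> C \<boxtimes>\<^bsub>K\<^esub> D) id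
       (tensor_map K (C \<boxtimes>\<^bsub>K\<^esub> D) D (D \<boxtimes>\<^bsub>K\<^esub> C) D \<Psi> id)
   \<circ> tensor_map K C (C \<boxtimes>\<^bsub>K\<^esub> (D \<boxtimes>\<^bsub>K\<^esub> D)) C (C \<boxtimes>\<^bsub>K\<^esub> D \<boxtimes>\<^bsub>K\<^esub> D) id (assoc_left K C D D)
   \<circ> assoc_right K C C (D \<boxtimes>\<^bsub>K\<^esub> D)
   \<circ> tensor_map K C D (C \<boxtimes>\<^bsub>K\<^esub> C) (D \<boxtimes>\<^bsub>K\<^esub> D) \<Delta>\<^bsub>C\<^esub> \<Delta>\<^bsub>D\<^esub>"

text \<open>The coassociativity condition on \<open>\<Psi>\<close>; both sides are maps
  \<open>C \<otimes> D \<rightarrow> (D \<otimes> C) \<otimes> (D \<otimes> C)\<close>.\<close>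

definition twist_coassociative ::
  "('k, 'r) ring_scheme \<Rightarrow> ('k, 'c, 'x) coalgebra_scheme \<Rightarrow> ('k, 'd, 'y) coalgebra_scheme
    \<Rightarrow> (('c \<times> 'd \<Rightarrow> 'k) set \<Rightarrow> ('d \<times> 'c \<Rightarrow> 'k) set) \<Rightarrow> bool" where
  "twist_coassociative K C D \<Psi> \<longleftrightarrow> (\<forall>x\<in>carrier (C \<boxtimes>\<^bsub>K\<^esub> D).
     (  tensor_map K (D \<boxtimes>\<^bsub>K\<^esub> C) (C \<boxtimes>\<^bsub>K\<^esub> D) (D \<boxtimes>\<^bsub>K\<^esub> C) (D \<boxtimes>\<^bsub>K\<^esub> C) id \<Psi>
      \<circ> assoc_right K (D \<boxtimes>\<^bsub>K\<^esub> C) C D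
      \<circ> tensor_map K (D \<boxtimes>\<^bsub>K\<^esub> (C \<boxtimes>\<^bsub>K\<^esub> C)) D (D \<boxtimes>\<^bsub>K\<^esub> C \<boxtimes>\<^bsub>K\<^esub> C) D (assoc_left K D C C) id
      \<circ> tensor_map K (D \<boxtimes>\<^bsub>K\<^esub> C) D (D \<boxtimes>\<^bsub>K\<^esub> (C \<boxtimes>\<^bsub>K\<^esub> C)) D
          (tensor_map K D C D (C \<boxtimes>\<^bsub>K\<^esub> C) id \<Delta>\<^bsub>C\<^esub>) id
      \<circ> tensor_map K (C \<boxtimes>\<^bsub>K\<^esub> D) D (D \<boxtimes>\<^bsub>K\<^esub> C) D \<Psi> id
      \<circ> assoc_left K C D D
      \<circ> tensor_map K C D C (D \<boxtimes>\<^bsub>K\<^esub> D) id \<Delta>\<^bsub>D\<^esub>) x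
   = (  tensor_map K (C \<boxtimes>\<^bsub>K\<^esub> D) (D \<boxtimes>\<^bsub>K\<^esub> C) (D \<boxtimes>\<^bsub>K\<^esub> C) (D \<boxtimes>\<^bsub>K\<^esub> C) \<Psi> id
      \<circ> assoc_left K C D (D \<boxtimes>\<^bsub>K\<^esub> C)
      \<circ> tensor_map K C (D \<boxtimes>\<^bsub>K\<^esub> D \<boxtimes>\<^bsub>K\<^esub> C) C (D \<boxtimes>\<^bsub>K\<^esub> (D \<boxtimes>\<^bsub>K\<^esub> C)) id (assoc_right K D D C)
      \<circ> tensor_map K C (D \<boxtimes>\<^bsub>K\<^esub> C) C (D \<boxtimes>\<^bsub>K\<^esub> D \<boxtimes>\<^bsub>K\<^esub> C) id
          (tensor_map K D C (D \<boxtimes>\<^bsub>K\<^esub> D) C \<Delta>\<^bsub>D\<^esub> id)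
      \<circ> tensor_map K C (C \<boxtimes>\<^bsub>K\<^esub> D) C (D \<boxtimes>\<^bsub>K\<^esub> C) id \<Psi>
      \<circ> assoc_right K C C D
      \<circ> tensor_map K C D (C \<boxtimes>\<^bsub>K\<^esub> C) D \<Delta>\<^bsub>C\<^esub> id) x)"

definition twisted_tensor ::
  "('k, 'r) ring_scheme \<Rightarrow> ('k, 'c, 'x) coalgebra_scheme \<Rightarrow> ('k, 'd, 'y) coalgebra_scheme
    \<Rightarrow> (('c \<times> 'd \<Rightarrow> 'k) set \<Rightarrow> ('d \<times> 'c \<Rightarrow> 'k) set) \<Rightarrow> (('c \<times> 'd \<Rightarrow> 'k) set \<Rightarrow> 'k)
    \<Rightarrow> ('k, ('c \<times> 'd \<Rightarrow> 'k) set) coalgebra" where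
  "twisted_tensor K C D \<Psi> e =
    module.extend (C \<boxtimes>\<^bsub>K\<^esub> D) (coalgebra.fields (twisted_comult K C D \<Psi>) e)"

text \<open>\<open>c \<otimes> d \<mapsto> c\<^sub>(\<^sub>1\<^sub>) e (c\<^sub>(\<^sub>2\<^sub>) \<otimes> d)\<close> and \<open>c \<otimes> d \<mapsto> e (c \<otimes> d\<^sub>(\<^sub>1\<^sub>)) d\<^sub>(\<^sub>2\<^sub>)\<close>.\<close>

definition proj_left ::
  "('k, 'r) ring_scheme \<Rightarrow> ('k, 'c, 'x) coalgebra_scheme \<Rightarrow> ('k, 'd, 'y) coalgebra_scheme
    \<Rightarrow> (('c \<times> 'd \<Rightarrow> 'k) set \<Rightarrow> 'k) \<Rightarrow> ('c \<times> 'd \<Rightarrow> 'k) set \<Rightarrow> 'c" where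
  "proj_left K C D e = tensor_lift K C D C
    (\<lambda>c d. tensor_lift K C C C (\<lambda>c1 c2. e (pure_tensor K C D c2 d) \<odot>\<^bsub>C\<^esub> c1) (\<Delta>\<^bsub>C\<^esub> c))"

definition proj_right ::
  "('k, 'r) ring_scheme \<Rightarrow> ('k, 'c, 'x) coalgebra_scheme \<Rightarrow> ('k, 'd, 'y) coalgebra_scheme
    \<Rightarrow> (('c \<times> 'd \<Rightarrow> 'k) set \<Rightarrow> 'k) \<Rightarrow> ('c \<times> 'd \<Rightarrow> 'k) set \<Rightarrow> 'd" where
  "proj_right K C D e = tensor_lift K C D D
    (\<lambda>c d. tensor_lift K D D D (\<lambda>d1 d2. e (pure_tensor K C D c d1) \<odot>\<^bsub>D\<^esub> d2) (\<Delta>\<^bsub>D\<^esub> d))"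

end

theory Submission
  imports Defs
begin

text \<open>
  The morphism is \<open>\<omega> = (u\<^sub>C \<otimes> u\<^sub>D) \<circ> \<Delta>\<^sub>Y\<close>, that is, \<open>\<omega> y = u\<^sub>C y\<^sub>(\<^sub>1\<^sub>) \<otimes> u\<^sub>D y\<^sub>(\<^sub>2\<^sub>)\<close>.  In Sweedler notation the whole
  argument is short.  Because \<open>u\<^sub>C\<close> and \<open>u\<^sub>D\<close> are comultiplicative,
  \<open>\<Delta>\<^sub>\<Psi> (\<omega> y) = u\<^sub>C y\<^sub>(\<^sub>1\<^sub>) \<otimes> \<Psi> (u\<^sub>C y\<^sub>(\<^sub>2\<^sub>) \<otimes> u\<^sub>D y\<^sub>(\<^sub>3\<^sub>)) \<otimes> u\<^sub>D y\<^sub>(\<^sub>4\<^sub>)\<close>; the twist hypothesis replaces the middle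
  part by \<open>u\<^sub>D y\<^sub>(\<^sub>2\<^sub>) \<otimes> u\<^sub>C y\<^sub>(\<^sub>3\<^sub>)\<close>, and the result is \<open>\<omega> y\<^sub>(\<^sub>1\<^sub>) \<otimes> \<omega> y\<^sub>(\<^sub>2\<^sub>)\<close>.  Compatibility with the counits is the
  last hypothesis.  Finally \<open>p\<^sub>C (\<omega> y) = u\<^sub>C y\<^sub>(\<^sub>1\<^sub>) \<epsilon>\<^sub>\<Psi> (\<omega> y\<^sub>(\<^sub>2\<^sub>)) = u\<^sub>C y\<^sub>(\<^sub>1\<^sub>) \<epsilon>\<^sub>Y y\<^sub>(\<^sub>2\<^sub>) = u\<^sub>C y\<close>, and \<open>p\<^sub>D\<close> is symmetric.

  Sweedler notation leaves the reassociations implicit, whereas here iterated tensor products in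
  different bracketings are different spaces.  The bookkeeping is done by the product
  \<open>f * g = (f \<otimes> g) \<circ> \<Delta>\<^sub>Y\<close> of linear maps out of \<open>Y\<close>, called \<open>convolution\<close> below.  It turns the
  structure of \<open>Y\<close> into three rules: post-composition acts factor by factor
  (\<open>tensor_map_convolution\<close>), the canonical isomorphisms carry \<open>(f * g) * h\<close> to \<open>f * (g * h)\<close> and
  back (\<open>assoc_right_convolution\<close>, \<open>assoc_left_convolution\<close>), and \<open>\<epsilon>\<^sub>Y\<close> is a two-sided unit
  (\<open>unit_left_convolution_counit\<close>, \<open>unit_right_convolution_counit\<close>).  A coalgebra morphism \<open>u\<close>
  satisfies \<open>\<Delta> \<circ> u = u * u\<close>, so with \<open>\<omega> = u\<^sub>C * u\<^sub>D\<close> every claim becomes a chain of such rewritings.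

  The rules rest on the universal property of the tensor product: it is a vector space generated
  by pure tensors (\<open>tensor_induct\<close>), and bilinear maps factor uniquely through it
  (\<open>tensor_lift_linear\<close>, \<open>tensor_lift_pure\<close>, \<open>tensor_lift_unique\<close>).
\<close>

section \<open>Linear maps and quotients\<close>

lemma linear_mapI:
  assumes "vectorspace K V" "vectorspace K W"
    and "\<And>v. v \<in> carrier V \<Longrightarrow> f v \<in> carrier W"
    and "\<And>u v. u \<in> carrier V \<Longrightarrow> v \<in> carrier V \<Longrightarrow> f (u \<oplus>\<^bsub>V\<^esub> v) = f u \<oplus>\<^bsub>W\<^esub> f v"
    and "\<And>a v. a \<in> carrier K \<Longrightarrow> v \<in> carrier V \<Longrightarrow> f (a \<odot>\<^bsub>V\<^esub> v) = a \<odot>\<^bsub>W\<^esub> f v"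
  shows "linear_map K V W f"
  using assms unfolding linear_map_def mod_hom_def mod_hom_axioms_def module_hom_def vectorspace_def
  by auto

lemma linear_mapD:
  assumes "linear_map K V W f"
  shows linear_map_source: "vectorspace K V" and linear_map_target: "vectorspace K W"
    and linear_map_closed: "\<And>v. v \<in> carrier V \<Longrightarrow> f v \<in> carrier W"
    and linear_map_add: "\<And>u v. u \<in> carrier V \<Longrightarrow> v \<in> carrier V \<Longrightarrow> f (u \<oplus>\<^bsub>V\<^esub> v) = f u \<oplus>\<^bsub>W\<^esub> f v"
    and linear_map_smult:
      "\<And>a v. a \<in> carrier K \<Longrightarrow> v \<in> carrier V \<Longrightarrow> f (a \<odot>\<^bsub>V\<^esub> v) = a \<odot>\<^bsub>W\<^esub> f v"
    and linear_map_zero: "f \<zero>\<^bsub>V\<^esub> = \<zero>\<^bsub>W\<^esub>"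
proof -
  interpret linear_map K V W f by (fact assms)
  show "vectorspace K V" "vectorspace K W" by unfold_locales
  show "\<And>v. v \<in> carrier V \<Longrightarrow> f v \<in> carrier W"
    "\<And>u v. u \<in> carrier V \<Longrightarrow> v \<in> carrier V \<Longrightarrow> f (u \<oplus>\<^bsub>V\<^esub> v) = f u \<oplus>\<^bsub>W\<^esub> f v"
    "\<And>a v. a \<in> carrier K \<Longrightarrow> v \<in> carrier V \<Longrightarrow> f (a \<odot>\<^bsub>V\<^esub> v) = a \<odot>\<^bsub>W\<^esub> f v"
    "f \<zero>\<^bsub>V\<^esub> = \<zero>\<^bsub>W\<^esub>"
    by simp_all
qed

lemma linear_map_compose:
  assumes f: "linear_map K U V f" and g: "linear_map K V W g"
  shows "linear_map K U W (\<lambda>x. g (f x))"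
  by (rule linear_mapI)
    (simp_all add: linear_mapD[OF f] linear_mapD[OF g])

lemma linear_map_id: "vectorspace K V \<Longrightarrow> linear_map K V V id"
  by (rule linear_mapI) simp_all

lemma linear_map_cong:
  assumes f: "linear_map K V W f" and eq: "\<And>v. v \<in> carrier V \<Longrightarrow> g v = f v"
  shows "linear_map K V W g"
proof -
  interpret V: vectorspace K V by (rule linear_map_source[OF f])
  show ?thesis
    by (rule linear_mapI[OF linear_mapD(1,2)[OF f]]) (simp_all add: eq linear_mapD(3-5)[OF f])
qed

lemma linear_map_sum:
  assumes f: "linear_map K V W f" and g: "linear_map K V W g"
  shows "linear_map K V W (\<lambda>v. f v \<oplus>\<^bsub>W\<^esub> g v)"
proof -
  interpret W: vectorspace K W by (rule linear_map_target[OF f])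
  show ?thesis
    by (rule linear_mapI[OF linear_mapD(1,2)[OF f]])
      (simp_all add: linear_mapD(3-5)[OF f] linear_mapD(3-5)[OF g] W.smult_r_distr W.a_ac)
qed

lemma submodule_abelian_subgroup:
  assumes "module K V" "submodule K W V"
  shows "abelian_subgroup W V"
proof -
  interpret V: module K V by fact
  interpret W: submodule K W V by fact
  have "subgroup W (add_monoid V)"
  proof (rule V.add.subgroupI)
    fix x assume x: "x \<in> W"
    then have "\<ominus>\<^bsub>V\<^esub> x = (\<ominus>\<^bsub>K\<^esub> \<one>\<^bsub>K\<^esub>) \<odot>\<^bsub>V\<^esub> x"
      using W.subset by (simp add: subsetD V.smult_l_minus)
    then show "\<ominus>\<^bsub>V\<^esub> x \<in> W"
      using x by simp
  qed (use W.subset W.zero_closed in \<open>auto simp del: W.zero_closed\<close>)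
  then show ?thesis
    by (rule abelian_subgroupI3[OF additive_subgroupI]) unfold_locales
qed

text \<open>
  The scalar action on the quotient takes a union over all representatives of a coset; it is the
  coset of \<open>a v\<close> because \<open>a (w + v) = a w + a v\<close> with \<open>a w\<close> in the subspace.  Every axiom then
  descends along the projection, which is therefore linear.
\<close>

lemma quotient_space_linear:
  assumes V: "vectorspace K V" and W: "submodule K W V"
  shows "linear_map K V (quotient_space V W) (\<lambda>v. W +>\<^bsub>V\<^esub> v)"
proof -
  interpret V: vectorspace K V by fact
  interpret W: submodule K W V by fact
  interpret W: abelian_subgroup W V
    by (rule submodule_abelian_subgroup) (fact V.module_axioms W)+
  let ?Q = "quotient_space V W" and ?p = "\<lambda>v. W +>\<^bsub>V\<^esub> v"
  have carrier: "carrier ?Q = ?p ` carrier V"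
    by (auto simp: quotient_space_def A_RCOSETS_def')
  have add: "?p u \<oplus>\<^bsub>?Q\<^esub> ?p v = ?p (u \<oplus>\<^bsub>V\<^esub> v)" if "u \<in> carrier V" "v \<in> carrier V" for u v
    using that by (simp add: quotient_space_def W.a_rcos_sum)
  have smult: "a \<odot>\<^bsub>?Q\<^esub> ?p v = ?p (a \<odot>\<^bsub>V\<^esub> v)" if a: "a \<in> carrier K" and v: "v \<in> carrier V" for a v
  proof -
    have "?p (a \<odot>\<^bsub>V\<^esub> x) = ?p (a \<odot>\<^bsub>V\<^esub> v)" if x: "x \<in> ?p v" for x
    proof -
      from x obtain w where w: "w \<in> W" "x = w \<oplus>\<^bsub>V\<^esub> v"
        by (auto simp: a_r_coset_def')
      then have wc: "w \<in> carrier V"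
        using W.subset by auto
      have "a \<odot>\<^bsub>V\<^esub> x = a \<odot>\<^bsub>V\<^esub> w \<oplus>\<^bsub>V\<^esub> a \<odot>\<^bsub>V\<^esub> v"
        using w wc a v by (simp add: V.smult_r_distr)
      moreover have "a \<odot>\<^bsub>V\<^esub> w \<oplus>\<^bsub>V\<^esub> a \<odot>\<^bsub>V\<^esub> v \<in> ?p (a \<odot>\<^bsub>V\<^esub> v)"
        using w a v by (intro V.a_rcosI W.smult_closed W.a_subset) auto
      ultimately show ?thesis
        using a v by (metis V.a_repr_independence V.smult_closed W.a_subgroup)
    qed
    moreover have "v \<in> ?p v"
      using v by (rule W.a_rcos_self)
    ultimately have "(\<Union>x\<in>?p v. ?p (a \<odot>\<^bsub>V\<^esub> x)) = ?p (a \<odot>\<^bsub>V\<^esub> v)"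
      by blast
    then show ?thesis
      by (simp add: quotient_space_def)
  qed
  have zero: "\<zero>\<^bsub>?Q\<^esub> = ?p \<zero>\<^bsub>V\<^esub>"
    by (simp add: quotient_space_def W.a_subset)
  have inv: "\<exists>y\<in>carrier V. ?p x \<oplus>\<^bsub>?Q\<^esub> ?p y = \<zero>\<^bsub>?Q\<^esub>" if "x \<in> carrier V" for x
    using that by (intro bexI[of _ "\<ominus>\<^bsub>V\<^esub> x"]) (simp_all add: add zero V.r_neg)
  have "module K ?Q"
  proof (rule module_criteria)
    show "cring K" by unfold_locales
  qed (use inv in \<open>auto simp: carrier add smult zero V.smult_l_distr V.smult_r_distr V.smult_assoc1
      V.a_ac\<close>)
  then have "vectorspace K ?Q"
    by (simp add: vectorspace_def V.field_axioms)
  then show ?thesis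
    using V by (intro linear_mapI) (simp_all add: add smult carrier)
qed

lemma quotient_space_carrier: "carrier (quotient_space V W) = (\<lambda>v. W +>\<^bsub>V\<^esub> v) ` carrier V"
  by (auto simp: quotient_space_def A_RCOSETS_def')

section \<open>Free vector spaces\<close>

lemma free_space_simps:
  assumes "ring K"
  shows carrier_free_space: "carrier (free_space K S) =
      {\<phi> \<in> S \<rightarrow>\<^sub>E carrier K. finite {s \<in> S. \<phi> s \<noteq> \<zero>\<^bsub>K\<^esub>}}"
    and add_free_space: "\<phi> \<oplus>\<^bsub>free_space K S\<^esub> \<psi> = (\<lambda>s\<in>S. \<phi> s \<oplus>\<^bsub>K\<^esub> \<psi> s)"
    and zero_free_space: "\<zero>\<^bsub>free_space K S\<^esub> = (\<lambda>s\<in>S. \<zero>\<^bsub>K\<^esub>)"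
    and smult_free_space: "a \<odot>\<^bsub>free_space K S\<^esub> \<phi> = (\<lambda>s\<in>S. a \<otimes>\<^bsub>K\<^esub> \<phi> s)"
  by (simp_all add: free_space_def ring.func_space_def[OF assms])

lemma free_space_vectorspace:
  assumes "field K"
  shows "vectorspace K (free_space K S)"
proof -
  interpret K: field K by fact
  interpret U: module K "K.func_space S" by (rule K.func_space_is_module)
  note simps = free_space_simps[OF K.ring_axioms]
  have "submodule K (carrier (free_space K S)) (K.func_space S)"
  proof (unfold_locales)
    fix \<phi> \<psi> assume *: "\<phi> \<in> carrier (free_space K S)" "\<psi> \<in> carrier (free_space K S)"
    then have "finite ({s \<in> S. \<phi> s \<noteq> \<zero>\<^bsub>K\<^esub>} \<union> {s \<in> S. \<psi> s \<noteq> \<zero>\<^bsub>K\<^esub>})"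
      by (simp add: simps)
    then have "finite {s \<in> S. \<phi> s \<oplus>\<^bsub>K\<^esub> \<psi> s \<noteq> \<zero>\<^bsub>K\<^esub>}"
      by (rule rev_finite_subset) auto
    then show "\<phi> \<oplus>\<^bsub>K.func_space S\<^esub> \<psi> \<in> carrier (free_space K S)"
      using * by (auto simp: simps K.func_space_def PiE_mem cong: conj_cong)
  next
    fix a \<phi> assume *: "a \<in> carrier K" "\<phi> \<in> carrier (free_space K S)"
    then have "finite {s \<in> S. \<phi> s \<noteq> \<zero>\<^bsub>K\<^esub>}"
      by (simp add: simps)
    then have "finite {s \<in> S. a \<otimes>\<^bsub>K\<^esub> \<phi> s \<noteq> \<zero>\<^bsub>K\<^esub>}"
      using * by (rule_tac rev_finite_subset) auto
    then show "a \<odot>\<^bsub>K.func_space S\<^esub> \<phi> \<in> carrier (free_space K S)"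
      using * by (auto simp: simps K.func_space_def PiE_mem cong: conj_cong)
  qed (auto simp: simps K.func_space_def cong: conj_cong)
  then have "module K (free_space K S)"
    using U.submodule_is_module by (auto simp: free_space_def)
  then show ?thesis
    by (simp add: vectorspace_def K.field_axioms)
qed

lemma free_gen_closed:
  assumes "ring K" "s \<in> S"
  shows "free_gen K S s \<in> carrier (free_space K S)"
proof -
  interpret ring K by fact
  have "finite {t \<in> S. free_gen K S s t \<noteq> \<zero>\<^bsub>K\<^esub>}"
    by (rule finite_subset[of _ "{s}"]) (auto simp: free_gen_def)
  then show ?thesis
    by (auto simp: carrier_free_space[OF \<open>ring K\<close>] free_gen_def)
qed

text \<open>
  Induction on the size of the support: clearing the value at one point \<open>s\<close> removes the summand
  \<open>\<phi> s\<close> times the generator of \<open>s\<close>.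
\<close>

lemma free_space_induct [consumes 2, case_names zero add]:
  assumes K: "field K" and \<phi>: "\<phi> \<in> carrier (free_space K S)"
    and zero: "P \<zero>\<^bsub>free_space K S\<^esub>"
    and add: "\<And>a s \<psi>. a \<in> carrier K \<Longrightarrow> s \<in> S \<Longrightarrow> \<psi> \<in> carrier (free_space K S) \<Longrightarrow> P \<psi> \<Longrightarrow>
      P (a \<odot>\<^bsub>free_space K S\<^esub> free_gen K S s \<oplus>\<^bsub>free_space K S\<^esub> \<psi>)"
  shows "P \<phi>"
proof -
  interpret K: field K by fact
  note simps = free_space_simps[OF K.ring_axioms]
  have "P \<phi>" if "finite A" "\<phi> \<in> carrier (free_space K S)" "{s \<in> S. \<phi> s \<noteq> \<zero>\<^bsub>K\<^esub>} \<subseteq> A" for A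
    using that
  proof (induction A arbitrary: \<phi> rule: finite_induct)
    case empty
    have "\<phi> = \<zero>\<^bsub>free_space K S\<^esub>"
      by (rule extensionalityI[of _ S]) (use empty in \<open>auto simp: simps PiE_def\<close>)
    then show ?case
      using zero by simp
  next
    case (insert s A)
    show ?case
    proof (cases "s \<in> S")
      case False
      with insert show ?thesis by blast
    next
      case True
      let ?\<psi> = "\<phi>(s := \<zero>\<^bsub>K\<^esub>)"
      have fin: "finite {t \<in> S. \<phi> t \<noteq> \<zero>\<^bsub>K\<^esub>}"
        using insert.prems by (simp add: simps)
      have "finite {t \<in> S. ?\<psi> t \<noteq> \<zero>\<^bsub>K\<^esub>}"
        using fin by (rule rev_finite_subset) auto
      then have \<psi>: "?\<psi> \<in> carrier (free_space K S)"
        using insert.prems True by (auto simp: simps PiE_def extensional_def)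
      moreover have "{t \<in> S. ?\<psi> t \<noteq> \<zero>\<^bsub>K\<^esub>} \<subseteq> A"
        using insert.prems by auto
      ultimately have "P ?\<psi>"
        by (rule insert.IH)
      have val: "\<phi> t \<in> carrier K" if "t \<in> S" for t
        using insert.prems that by (auto simp: simps)
      have "\<phi> = \<phi> s \<odot>\<^bsub>free_space K S\<^esub> free_gen K S s \<oplus>\<^bsub>free_space K S\<^esub> ?\<psi>"
        by (rule extensionalityI[of _ S])
          (use insert.prems True val in \<open>auto simp: simps free_gen_def PiE_def\<close>)
      then show ?thesis
        using add[OF val[OF True] True \<psi> \<open>P ?\<psi>\<close>] by simp
    qed
  qed
  then show ?thesis
    using \<phi> by (auto simp: simps)
qed

definition linear_extension ::
  "('k, 'r) ring_scheme \<Rightarrow> 's set \<Rightarrow> ('k, 'p, 'z) module_scheme \<Rightarrow> ('s \<Rightarrow> 'p) \<Rightarrow> ('s \<Rightarrow> 'k) \<Rightarrow> 'p" where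
  "linear_extension K S P h \<phi> = (\<Oplus>\<^bsub>P\<^esub> s \<in> {s \<in> S. \<phi> s \<noteq> \<zero>\<^bsub>K\<^esub>}. \<phi> s \<odot>\<^bsub>P\<^esub> h s)"

text \<open>
  Summing over any finite set that contains the support allows two functions with different
  supports to be compared term by term.
\<close>

lemma linear_extension_superset:
  assumes P: "vectorspace K P" and h: "\<And>s. s \<in> S \<Longrightarrow> h s \<in> carrier P"
    and \<phi>: "\<phi> \<in> S \<rightarrow> carrier K" and A: "finite A" "A \<subseteq> S" "{s \<in> S. \<phi> s \<noteq> \<zero>\<^bsub>K\<^esub>} \<subseteq> A"
  shows "linear_extension K S P h \<phi> = (\<Oplus>\<^bsub>P\<^esub> s \<in> A. \<phi> s \<odot>\<^bsub>P\<^esub> h s)"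
proof -
  interpret P: vectorspace K P by fact
  show ?thesis
    unfolding linear_extension_def
    by (rule P.add.finprod_mono_neutral_cong_left) (use assms in \<open>auto simp: Pi_iff\<close>)
qed

lemma linear_extension_linear:
  assumes P: "vectorspace K P" and h: "\<And>s. s \<in> S \<Longrightarrow> h s \<in> carrier P"
  shows "linear_map K (free_space K S) P (linear_extension K S P h)"
proof -
  interpret P: vectorspace K P by fact
  note simps = free_space_simps[OF P.ring_axioms]
  have F: "vectorspace K (free_space K S)"
    by (rule free_space_vectorspace) unfold_locales
  interpret F: vectorspace K "free_space K S" by (fact F)
  have val: "\<phi> s \<in> carrier K" if "\<phi> \<in> carrier (free_space K S)" "s \<in> S" for \<phi> s
    using that by (auto simp: simps)
  let ?supp = "\<lambda>\<phi>. {s \<in> S. \<phi> s \<noteq> \<zero>\<^bsub>K\<^esub>}"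
  show ?thesis
  proof (rule linear_mapI)
    fix \<phi> assume "\<phi> \<in> carrier (free_space K S)"
    then show "linear_extension K S P h \<phi> \<in> carrier P"
      unfolding linear_extension_def
      by (intro P.finsum_closed) (auto simp: val h)
  next
    fix \<phi> \<psi> assume *: "\<phi> \<in> carrier (free_space K S)" "\<psi> \<in> carrier (free_space K S)"
    let ?A = "?supp \<phi> \<union> ?supp \<psi>"
    have fin: "finite ?A"
      using * by (simp add: simps)
    have "linear_extension K S P h (\<phi> \<oplus>\<^bsub>free_space K S\<^esub> \<psi>) =
        (\<Oplus>\<^bsub>P\<^esub> s \<in> ?A. (\<phi> \<oplus>\<^bsub>free_space K S\<^esub> \<psi>) s \<odot>\<^bsub>P\<^esub> h s)"
      by (rule linear_extension_superset[OF P h _ fin]) (use * val in \<open>auto simp: simps\<close>)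
    also have "\<dots> = (\<Oplus>\<^bsub>P\<^esub> s \<in> ?A. \<phi> s \<odot>\<^bsub>P\<^esub> h s \<oplus>\<^bsub>P\<^esub> \<psi> s \<odot>\<^bsub>P\<^esub> h s)"
      by (rule P.finsum_cong') (use * val h in \<open>auto simp: simps(2) P.smult_l_distr\<close>)
    also have "\<dots> = (\<Oplus>\<^bsub>P\<^esub> s \<in> ?A. \<phi> s \<odot>\<^bsub>P\<^esub> h s) \<oplus>\<^bsub>P\<^esub> (\<Oplus>\<^bsub>P\<^esub> s \<in> ?A. \<psi> s \<odot>\<^bsub>P\<^esub> h s)"
      by (rule P.finsum_addf) (use * val h in auto)
    also have "(\<Oplus>\<^bsub>P\<^esub> s \<in> ?A. \<phi> s \<odot>\<^bsub>P\<^esub> h s) = linear_extension K S P h \<phi>"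
      by (rule linear_extension_superset[OF P h _ fin, symmetric]) (use * val in \<open>auto simp: simps\<close>)
    also have "(\<Oplus>\<^bsub>P\<^esub> s \<in> ?A. \<psi> s \<odot>\<^bsub>P\<^esub> h s) = linear_extension K S P h \<psi>"
      by (rule linear_extension_superset[OF P h _ fin, symmetric]) (use * val in \<open>auto simp: simps\<close>)
    finally show "linear_extension K S P h (\<phi> \<oplus>\<^bsub>free_space K S\<^esub> \<psi>) =
        linear_extension K S P h \<phi> \<oplus>\<^bsub>P\<^esub> linear_extension K S P h \<psi>" .
  next
    fix a \<phi> assume a: "a \<in> carrier K" and \<phi>: "\<phi> \<in> carrier (free_space K S)"
    have fin: "finite (?supp \<phi>)"
      using \<phi> by (simp add: simps)
    have "linear_extension K S P h (a \<odot>\<^bsub>free_space K S\<^esub> \<phi>) =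
        (\<Oplus>\<^bsub>P\<^esub> s \<in> ?supp \<phi>. (a \<odot>\<^bsub>free_space K S\<^esub> \<phi>) s \<odot>\<^bsub>P\<^esub> h s)"
      by (rule linear_extension_superset[OF P h _ fin]) (use a \<phi> val in \<open>auto simp: simps\<close>)
    also have "\<dots> = (\<Oplus>\<^bsub>P\<^esub> s \<in> ?supp \<phi>. a \<odot>\<^bsub>P\<^esub> (\<phi> s \<odot>\<^bsub>P\<^esub> h s))"
      by (rule P.finsum_cong') (use a \<phi> val h in \<open>auto simp: simps(4) P.smult_assoc1\<close>)
    also have "\<dots> = a \<odot>\<^bsub>P\<^esub> linear_extension K S P h \<phi>"
      unfolding linear_extension_def
      by (rule P.finsum_smult_ldistr[symmetric]) (use a fin \<phi> val h in auto)
    finally show "linear_extension K S P h (a \<odot>\<^bsub>free_space K S\<^esub> \<phi>) =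
        a \<odot>\<^bsub>P\<^esub> linear_extension K S P h \<phi>" .
  qed (fact F P)+
qed

lemma linear_extension_gen:
  assumes P: "vectorspace K P" and h: "\<And>s. s \<in> S \<Longrightarrow> h s \<in> carrier P" and s: "s \<in> S"
  shows "linear_extension K S P h (free_gen K S s) = h s"
proof -
  interpret P: vectorspace K P by fact
  have "{t \<in> S. free_gen K S s t \<noteq> \<zero>\<^bsub>K\<^esub>} = {s}"
    using s by (auto simp: free_gen_def)
  then show ?thesis
    using s h by (simp add: linear_extension_def free_gen_def)
qed

section \<open>The universal property of the tensor product\<close>

text \<open>
  Linearity in each variable is only required at carrier elements of the other one, since functions
  carry no information outside the carriers.
\<close>

definition bilinear_map ::
  "('k, 'r) ring_scheme \<Rightarrow> ('k, 'm, 'x) module_scheme \<Rightarrow> ('k, 'n, 'y) module_scheme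
    \<Rightarrow> ('k, 'p, 'z) module_scheme \<Rightarrow> ('m \<Rightarrow> 'n \<Rightarrow> 'p) \<Rightarrow> bool" where
  "bilinear_map K M N P f \<longleftrightarrow> vectorspace K M \<and> vectorspace K N \<and> vectorspace K P \<and>
    (\<forall>n\<in>carrier N. linear_map K M P (\<lambda>m. f m n)) \<and> (\<forall>m\<in>carrier M. linear_map K N P (f m))"

lemma bilinear_mapI:
  assumes "vectorspace K M" "vectorspace K N" "vectorspace K P"
    and "\<And>n. n \<in> carrier N \<Longrightarrow> linear_map K M P (\<lambda>m. f m n)"
    and "\<And>m. m \<in> carrier M \<Longrightarrow> linear_map K N P (\<lambda>n. f m n)"
  shows "bilinear_map K M N P f"
  using assms by (simp add: bilinear_map_def)

lemma bilinear_mapD: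
  assumes "bilinear_map K M N P f"
  shows "vectorspace K M" "vectorspace K N" "vectorspace K P"
    and "\<And>n. n \<in> carrier N \<Longrightarrow> linear_map K M P (\<lambda>m. f m n)"
    and "\<And>m. m \<in> carrier M \<Longrightarrow> linear_map K N P (\<lambda>n. f m n)"
  using assms by (simp_all add: bilinear_map_def)

lemma bilinear_map_flip: "bilinear_map K M N P f \<Longrightarrow> bilinear_map K N M P (\<lambda>n m. f m n)"
  by (auto simp: bilinear_map_def)

lemma bilinear_map_compose:
  assumes b: "bilinear_map K M N P b"
    and f: "linear_map K M' M f" and g: "linear_map K N' N g" and h: "linear_map K P Q h"
  shows "bilinear_map K M' N' Q (\<lambda>m n. h (b (f m) (g n)))"
proof (rule bilinear_mapI)
  show "vectorspace K M'" "vectorspace K N'" "vectorspace K Q"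
    by (rule linear_map_source[OF f] linear_map_source[OF g] linear_map_target[OF h])+
  fix n assume "n \<in> carrier N'"
  then have "linear_map K M P (\<lambda>m. b m (g n))"
    by (intro bilinear_mapD(4)[OF b] linear_map_closed[OF g])
  from linear_map_compose[OF linear_map_compose[OF f this] h]
  show "linear_map K M' Q (\<lambda>m. h (b (f m) (g n)))" .
next
  fix m assume "m \<in> carrier M'"
  then have "linear_map K N P (\<lambda>n. b (f m) n)"
    by (intro bilinear_mapD(5)[OF b] linear_map_closed[OF f])
  from linear_map_compose[OF linear_map_compose[OF g this] h]
  show "linear_map K N' Q (\<lambda>n. h (b (f m) (g n)))" .
qed

lemma tensor_relationsI:
  fixes K :: "('k, 'r) ring_scheme" and M :: "('k, 'm, 'x) module_scheme"
    and N :: "('k, 'n, 'y) module_scheme"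
  defines "F \<equiv> free_space K (carrier M \<times> carrier N)"
    and "g \<equiv> \<lambda>m n. free_gen K (carrier M \<times> carrier N) (m, n)"
  shows "m \<in> carrier M \<Longrightarrow> m' \<in> carrier M \<Longrightarrow> n \<in> carrier N \<Longrightarrow>
      g (m \<oplus>\<^bsub>M\<^esub> m') n \<ominus>\<^bsub>F\<^esub> (g m n \<oplus>\<^bsub>F\<^esub> g m' n) \<in> tensor_relations K M N"
    and "m \<in> carrier M \<Longrightarrow> n \<in> carrier N \<Longrightarrow> n' \<in> carrier N \<Longrightarrow>
      g m (n \<oplus>\<^bsub>N\<^esub> n') \<ominus>\<^bsub>F\<^esub> (g m n \<oplus>\<^bsub>F\<^esub> g m n') \<in> tensor_relations K M N"
    and "a \<in> carrier K \<Longrightarrow> m \<in> carrier M \<Longrightarrow> n \<in> carrier N \<Longrightarrow>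
      g (a \<odot>\<^bsub>M\<^esub> m) n \<ominus>\<^bsub>F\<^esub> (a \<odot>\<^bsub>F\<^esub> g m n) \<in> tensor_relations K M N"
    and "a \<in> carrier K \<Longrightarrow> m \<in> carrier M \<Longrightarrow> n \<in> carrier N \<Longrightarrow>
      g m (a \<odot>\<^bsub>N\<^esub> n) \<ominus>\<^bsub>F\<^esub> (a \<odot>\<^bsub>F\<^esub> g m n) \<in> tensor_relations K M N"
  unfolding tensor_relations_def Let_def F_def g_def
proof goal_cases
  case 1 show ?case by (rule UnI1, rule UnI1, rule UnI1,
        rule CollectI, (rule exI)+, rule conjI, rule refl, intro conjI 1)
next
  case 2 show ?case by (rule UnI1, rule UnI1, rule UnI2,
        rule CollectI, (rule exI)+, rule conjI, rule refl, intro conjI 2)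
next
  case 3 show ?case by (rule UnI1, rule UnI2,
        rule CollectI, (rule exI)+, rule conjI, rule refl, intro conjI 3)
next
  case 4 show ?case by (rule UnI2,
        rule CollectI, (rule exI)+, rule conjI, rule refl, intro conjI 4)
qed

lemma tensor_relations_closed:
  assumes M: "vectorspace K M" and N: "vectorspace K N"
  shows "tensor_relations K M N \<subseteq> carrier (free_space K (carrier M \<times> carrier N))"
proof -
  interpret M: vectorspace K M by (fact M)
  interpret N: vectorspace K N by (fact N)
  interpret F: vectorspace K "free_space K (carrier M \<times> carrier N)"
    by (rule free_space_vectorspace) unfold_locales
  have gen: "free_gen K (carrier M \<times> carrier N) (m, n) \<in>
      carrier (free_space K (carrier M \<times> carrier N))"
    if "m \<in> carrier M" "n \<in> carrier N" for m n
    using that by (intro free_gen_closed M.ring_axioms) auto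
  show ?thesis
    unfolding tensor_relations_def Let_def
    by (intro Un_least subsetI; clarify; intro F.minus_closed F.a_closed F.smult_closed gen
        M.a_closed N.a_closed M.smult_closed N.smult_closed)
qed

lemma tensor_null_submodule:
  assumes M: "vectorspace K M" and N: "vectorspace K N"
  shows "submodule K (tensor_null K M N) (free_space K (carrier M \<times> carrier N))"
    and "tensor_relations K M N \<subseteq> tensor_null K M N"
proof -
  interpret M: vectorspace K M by (fact M)
  interpret F: vectorspace K "free_space K (carrier M \<times> carrier N)"
    by (rule free_space_vectorspace) unfold_locales
  note rel = tensor_relations_closed[OF M N]
  show "submodule K (tensor_null K M N) (free_space K (carrier M \<times> carrier N))"
    and "tensor_relations K M N \<subseteq> tensor_null K M N"
    unfolding tensor_null_def by (rule F.span_is_submodule[OF rel] F.in_own_span[OF rel])+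
qed

lemma tensor_projection_linear:
  assumes M: "vectorspace K M" and N: "vectorspace K N"
  shows "linear_map K (free_space K (carrier M \<times> carrier N)) (M \<boxtimes>\<^bsub>K\<^esub> N)
    (\<lambda>\<phi>. tensor_null K M N +>\<^bsub>free_space K (carrier M \<times> carrier N)\<^esub> \<phi>)"
proof -
  interpret M: vectorspace K M by (fact M)
  show ?thesis
    unfolding tensor_space_def
    by (intro quotient_space_linear free_space_vectorspace tensor_null_submodule M N) unfold_locales
qed

lemma tensor_vectorspace:
  assumes M: "vectorspace K M" and N: "vectorspace K N"
  shows "vectorspace K (M \<boxtimes>\<^bsub>K\<^esub> N)"
  by (rule linear_map_target[OF tensor_projection_linear[OF assms]])

lemma pure_tensor_bilinear:
  assumes M: "vectorspace K M" and N: "vectorspace K N"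
  shows "bilinear_map K M N (M \<boxtimes>\<^bsub>K\<^esub> N) (pure_tensor K M N)"
proof -
  interpret M: vectorspace K M by (fact M)
  interpret N: vectorspace K N by (fact N)
  let ?S = "carrier M \<times> carrier N"
  let ?F = "free_space K ?S" and ?W = "tensor_null K M N" and ?T = "M \<boxtimes>\<^bsub>K\<^esub> N"
  let ?g = "\<lambda>m n. free_gen K ?S (m, n)"
  interpret F: vectorspace K ?F
    by (rule free_space_vectorspace) unfold_locales
  note W = tensor_null_submodule[OF M N]
  interpret W: abelian_subgroup ?W ?F
    by (rule submodule_abelian_subgroup[OF F.module_axioms W(1)])
  note p = tensor_projection_linear[OF M N]
  have eq: "?W +>\<^bsub>?F\<^esub> x = ?W +>\<^bsub>?F\<^esub> y"
    if "x \<ominus>\<^bsub>?F\<^esub> y \<in> tensor_relations K M N" "x \<in> carrier ?F" "y \<in> carrier ?F" for x y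
  proof (rule F.a_coset_add_inv1)
    show "?W +>\<^bsub>?F\<^esub> (x \<oplus>\<^bsub>?F\<^esub> (\<ominus>\<^bsub>?F\<^esub> y)) = ?W"
      using that W(2) by (intro F.a_coset_join2 W.a_subgroup) (auto simp: a_minus_def)
  qed (use that W.a_subset in auto)
  have g: "?g m n \<in> carrier ?F" if "m \<in> carrier M" "n \<in> carrier N" for m n
    using that by (intro free_gen_closed M.ring_axioms) auto
  note pt = pure_tensor_def
  note T = tensor_vectorspace[OF M N]
  show ?thesis
  proof (rule bilinear_mapI[OF M N T]; rule linear_mapI)
    fix m n assume "m \<in> carrier M" "n \<in> carrier N"
    then show "pure_tensor K M N m n \<in> carrier ?T" "pure_tensor K M N m n \<in> carrier ?T"
      unfolding pt using linear_map_closed[OF p] g by auto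
  next
    fix m m' n assume *: "m \<in> carrier M" "m' \<in> carrier M" "n \<in> carrier N"
    then have "?g (m \<oplus>\<^bsub>M\<^esub> m') n \<ominus>\<^bsub>?F\<^esub> (?g m n \<oplus>\<^bsub>?F\<^esub> ?g m' n) \<in> tensor_relations K M N"
      by (intro tensor_relationsI(1))
    from eq[OF this] * show "pure_tensor K M N (m \<oplus>\<^bsub>M\<^esub> m') n =
        pure_tensor K M N m n \<oplus>\<^bsub>?T\<^esub> pure_tensor K M N m' n"
      by (simp add: pt g flip: linear_map_add[OF p])
  next
    fix m n n' assume *: "m \<in> carrier M" "n \<in> carrier N" "n' \<in> carrier N"
    then have "?g m (n \<oplus>\<^bsub>N\<^esub> n') \<ominus>\<^bsub>?F\<^esub> (?g m n \<oplus>\<^bsub>?F\<^esub> ?g m n') \<in> tensor_relations K M N"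
      by (intro tensor_relationsI(2))
    from eq[OF this] * show "pure_tensor K M N m (n \<oplus>\<^bsub>N\<^esub> n') =
        pure_tensor K M N m n \<oplus>\<^bsub>?T\<^esub> pure_tensor K M N m n'"
      by (simp add: pt g flip: linear_map_add[OF p])
  next
    fix a m n assume *: "a \<in> carrier K" "m \<in> carrier M" "n \<in> carrier N"
    then have "?g (a \<odot>\<^bsub>M\<^esub> m) n \<ominus>\<^bsub>?F\<^esub> (a \<odot>\<^bsub>?F\<^esub> ?g m n) \<in> tensor_relations K M N"
      by (intro tensor_relationsI(3))
    from eq[OF this] * show "pure_tensor K M N (a \<odot>\<^bsub>M\<^esub> m) n = a \<odot>\<^bsub>?T\<^esub> pure_tensor K M N m n"
      by (simp add: pt g flip: linear_map_smult[OF p])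
  next
    fix a m n assume *: "a \<in> carrier K" "m \<in> carrier M" "n \<in> carrier N"
    then have "?g m (a \<odot>\<^bsub>N\<^esub> n) \<ominus>\<^bsub>?F\<^esub> (a \<odot>\<^bsub>?F\<^esub> ?g m n) \<in> tensor_relations K M N"
      by (intro tensor_relationsI(4))
    from eq[OF this] * show "pure_tensor K M N m (a \<odot>\<^bsub>N\<^esub> n) = a \<odot>\<^bsub>?T\<^esub> pure_tensor K M N m n"
      by (simp add: pt g flip: linear_map_smult[OF p])
  qed (simp_all add: M N T)
qed

lemma pure_tensor_closed:
  assumes "vectorspace K M" "vectorspace K N" "m \<in> carrier M" "n \<in> carrier N"
  shows "pure_tensor K M N m n \<in> carrier (M \<boxtimes>\<^bsub>K\<^esub> N)"
  by (rule linear_map_closed[OF bilinear_mapD(4)[OF pure_tensor_bilinear[OF assms(1,2)] assms(4)] assms(3)])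

text \<open>
  Pure tensors generate under addition alone: a scalar can be absorbed into the left factor of a
  pure tensor, and zero is the pure tensor of two zeros.
\<close>

lemma tensor_induct [consumes 3, case_names pure add]:
  assumes M: "vectorspace K M" and N: "vectorspace K N" and x: "x \<in> carrier (M \<boxtimes>\<^bsub>K\<^esub> N)"
    and pure: "\<And>m n. m \<in> carrier M \<Longrightarrow> n \<in> carrier N \<Longrightarrow> P (pure_tensor K M N m n)"
    and add: "\<And>x y. x \<in> carrier (M \<boxtimes>\<^bsub>K\<^esub> N) \<Longrightarrow> y \<in> carrier (M \<boxtimes>\<^bsub>K\<^esub> N) \<Longrightarrow> P x \<Longrightarrow> P y \<Longrightarrow>
      P (x \<oplus>\<^bsub>M \<boxtimes>\<^bsub>K\<^esub> N\<^esub> y)"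
  shows "P x"
proof -
  interpret M: vectorspace K M by (fact M)
  interpret N: vectorspace K N by (fact N)
  let ?S = "carrier M \<times> carrier N"
  let ?F = "free_space K ?S" and ?T = "M \<boxtimes>\<^bsub>K\<^esub> N"
  let ?p = "\<lambda>\<phi>. tensor_null K M N +>\<^bsub>?F\<^esub> \<phi>"
  interpret F: vectorspace K ?F
    by (rule free_space_vectorspace) unfold_locales
  note p = tensor_projection_linear[OF M N]
  note pure_linear = bilinear_mapD[OF pure_tensor_bilinear[OF M N]]
  have smult_gen: "?p (a \<odot>\<^bsub>?F\<^esub> free_gen K ?S (m, n)) = pure_tensor K M N (a \<odot>\<^bsub>M\<^esub> m) n"
    if "a \<in> carrier K" "m \<in> carrier M" "n \<in> carrier N" for a m n
  proof -
    have "free_gen K ?S (m, n) \<in> carrier ?F"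
      using that by (intro free_gen_closed M.ring_axioms) auto
    then have "?p (a \<odot>\<^bsub>?F\<^esub> free_gen K ?S (m, n)) = a \<odot>\<^bsub>?T\<^esub> pure_tensor K M N m n"
      unfolding pure_tensor_def using that(1) by (intro linear_map_smult[OF p])
    also have "\<dots> = pure_tensor K M N (a \<odot>\<^bsub>M\<^esub> m) n"
      using that by (intro linear_map_smult[OF pure_linear(4), symmetric])
    finally show ?thesis .
  qed
  obtain \<phi> where \<phi>: "\<phi> \<in> carrier ?F" "x = ?p \<phi>"
    using x by (auto simp: tensor_space_def quotient_space_carrier)
  from M.field_axioms \<phi>(1) have "P (?p \<phi>)"
  proof (induction rule: free_space_induct)
    case zero
    have "?p \<zero>\<^bsub>?F\<^esub> = pure_tensor K M N \<zero>\<^bsub>M\<^esub> \<zero>\<^bsub>N\<^esub>"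
      by (simp add: linear_map_zero[OF p] linear_map_zero[OF pure_linear(4)])
    then show ?case
      using pure by simp
  next
    case (add a s \<psi>)
    obtain m n where s: "s = (m, n)" "m \<in> carrier M" "n \<in> carrier N"
      using add by auto
    have "?p (a \<odot>\<^bsub>?F\<^esub> free_gen K ?S s \<oplus>\<^bsub>?F\<^esub> \<psi>) =
        pure_tensor K M N (a \<odot>\<^bsub>M\<^esub> m) n \<oplus>\<^bsub>?T\<^esub> ?p \<psi>"
      using add s
      by (simp add: linear_map_add[OF p] smult_gen free_gen_closed M.ring_axioms)
    moreover have "P \<dots>"
      using add s linear_map_closed[OF p add(3)]
      by (intro assms(5) pure pure_tensor_closed M N M.smult_closed) simp_all
    ultimately show ?case
      by simp
  qed
  then show ?thesis
    by (simp add: \<phi>)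
qed

lemma linear_map_eq_on_pure_tensors:
  assumes "linear_map K (M \<boxtimes>\<^bsub>K\<^esub> N) P f" "linear_map K (M \<boxtimes>\<^bsub>K\<^esub> N) P g"
    and "vectorspace K M" "vectorspace K N" "x \<in> carrier (M \<boxtimes>\<^bsub>K\<^esub> N)"
    and "\<And>m n. m \<in> carrier M \<Longrightarrow> n \<in> carrier N \<Longrightarrow>
      f (pure_tensor K M N m n) = g (pure_tensor K M N m n)"
  shows "f x = g x"
  using assms(3-5)
  by (induction rule: tensor_induct)
    (simp_all add: assms(6) linear_map_add[OF assms(1)] linear_map_add[OF assms(2)])

text \<open>
  The linear extension of a bilinear map kills the bilinearity relations, hence their span, hence
  is constant on each coset; so the value picked by \<^const>\<open>the_elem\<close> is the value at any
  representative.
\<close>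

lemma tensor_lift_coset:
  assumes f: "bilinear_map K M N P f"
    and \<phi>: "\<phi> \<in> carrier (free_space K (carrier M \<times> carrier N))"
  shows "tensor_lift K M N P f
      (tensor_null K M N +>\<^bsub>free_space K (carrier M \<times> carrier N)\<^esub> \<phi>) =
    linear_extension K (carrier M \<times> carrier N) P (\<lambda>s. f (fst s) (snd s)) \<phi>"
proof -
  note f' = bilinear_mapD[OF f]
  interpret M: vectorspace K M by (fact f')
  interpret N: vectorspace K N by (fact f')
  interpret P: vectorspace K P by (fact f')
  let ?S = "carrier M \<times> carrier N"
  let ?F = "free_space K ?S" and ?W = "tensor_null K M N"
  let ?L = "linear_extension K ?S P (\<lambda>s. f (fst s) (snd s))"
  have val: "f m n \<in> carrier P" if "m \<in> carrier M" "n \<in> carrier N" for m n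
    by (rule linear_map_closed[OF f'(4)[OF that(2)] that(1)])
  have L: "linear_map K ?F P ?L"
    by (rule linear_extension_linear[OF f'(3)]) (auto intro: val)
  interpret F: vectorspace K ?F by (rule linear_map_source[OF L])
  interpret L: linear_map K ?F P ?L by (fact L)
  have gen: "free_gen K ?S (m, n) \<in> carrier ?F" "?L (free_gen K ?S (m, n)) = f m n"
    if "m \<in> carrier M" "n \<in> carrier N" for m n
  proof -
    show "free_gen K ?S (m, n) \<in> carrier ?F"
      by (rule free_gen_closed[OF M.ring_axioms]) (simp add: that)
    have "?L (free_gen K ?S (m, n)) = f (fst (m, n)) (snd (m, n))"
      by (rule linear_extension_gen[OF f'(3)]) (auto intro: val simp: that)
    then show "?L (free_gen K ?S (m, n)) = f m n"
      by simp
  qed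
  have kerI: "x \<ominus>\<^bsub>?F\<^esub> y \<in> L.ker"
    if "?L x = ?L y" "x \<in> carrier ?F" "y \<in> carrier ?F" for x y
  proof -
    have "?L (x \<ominus>\<^bsub>?F\<^esub> y) = ?L y \<ominus>\<^bsub>P\<^esub> ?L y"
      using that by (simp only: L.f_minus)
    then show ?thesis
      using that linear_map_closed[OF L that(3)] by (simp add: L.ker_def P.r_neg a_minus_def)
  qed
  have "tensor_relations K M N \<subseteq> L.ker"
    unfolding tensor_relations_def Let_def
    by (intro Un_least subsetI; clarify; rule kerI)
      (simp_all add: gen linear_map_add[OF f'(4)] linear_map_add[OF f'(5)]
        linear_map_smult[OF f'(4)] linear_map_smult[OF f'(5)])
  then have "?W \<subseteq> L.ker"
    unfolding tensor_null_def by (rule F.span_is_subset) (fact L.ker_is_submodule)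
  have "?L \<psi> = ?L \<phi>" if \<psi>: "\<psi> \<in> ?W +>\<^bsub>?F\<^esub> \<phi>" for \<psi>
  proof -
    obtain w where w: "w \<in> ?W" "\<psi> = w \<oplus>\<^bsub>?F\<^esub> \<phi>"
      using \<psi> by (auto simp: a_r_coset_def')
    then have "w \<in> carrier ?F" "?L w = \<zero>\<^bsub>P\<^esub>"
      using \<open>?W \<subseteq> L.ker\<close> by (auto simp only: L.ker_def)
    then show ?thesis
      unfolding w(2) using \<phi> linear_map_closed[OF L \<phi>] by (simp only: L.f_add P.l_zero)
  qed
  moreover have "\<phi> \<in> ?W +>\<^bsub>?F\<^esub> \<phi>"
    using submodule_abelian_subgroup[OF F.module_axioms tensor_null_submodule(1)[OF f'(1,2)]] \<phi>
    by (rule abelian_subgroup.a_rcos_self)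
  ultimately have "?L ` (?W +>\<^bsub>?F\<^esub> \<phi>) = {?L \<phi>}"
    by blast
  then show ?thesis
    unfolding tensor_lift_def linear_extension_def by simp
qed

lemma tensor_lift_linear:
  assumes f: "bilinear_map K M N P f"
  shows "linear_map K (M \<boxtimes>\<^bsub>K\<^esub> N) P (tensor_lift K M N P f)"
proof -
  note f' = bilinear_mapD[OF f]
  let ?S = "carrier M \<times> carrier N"
  let ?F = "free_space K ?S" and ?T = "M \<boxtimes>\<^bsub>K\<^esub> N"
  let ?p = "\<lambda>\<phi>. tensor_null K M N +>\<^bsub>?F\<^esub> \<phi>"
  let ?L = "linear_extension K ?S P (\<lambda>s. f (fst s) (snd s))"
  have L: "linear_map K ?F P ?L"
    by (rule linear_extension_linear[OF f'(3)]) (use linear_map_closed[OF f'(4)] in auto)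
  interpret F: vectorspace K ?F by (rule linear_map_source[OF L])
  note p = tensor_projection_linear[OF f'(1,2)]
  have rep: "\<exists>\<phi>\<in>carrier ?F. x = ?p \<phi>" if "x \<in> carrier ?T" for x
    using that by (auto simp: tensor_space_def quotient_space_carrier)
  note lift = tensor_lift_coset[OF f]
  show ?thesis
  proof (rule linear_mapI)
    show "vectorspace K ?T" "vectorspace K P"
      by (rule tensor_vectorspace[OF f'(1,2)] f'(3))+
    show "tensor_lift K M N P f x \<in> carrier P" if "x \<in> carrier ?T" for x
      using rep[OF that] by (auto simp: lift linear_map_closed[OF L])
    show "tensor_lift K M N P f (x \<oplus>\<^bsub>?T\<^esub> y) = tensor_lift K M N P f x \<oplus>\<^bsub>P\<^esub> tensor_lift K M N P f y"
      if "x \<in> carrier ?T" "y \<in> carrier ?T" for x y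
      using rep[OF that(1)] rep[OF that(2)]
      by (auto simp: lift linear_map_add[OF L] simp flip: linear_map_add[OF p])
    show "tensor_lift K M N P f (a \<odot>\<^bsub>?T\<^esub> x) = a \<odot>\<^bsub>P\<^esub> tensor_lift K M N P f x"
      if "a \<in> carrier K" "x \<in> carrier ?T" for a x
      using rep[OF that(2)] that(1)
      by (auto simp: lift linear_map_smult[OF L] simp flip: linear_map_smult[OF p])
  qed
qed

lemma tensor_lift_pure:
  assumes f: "bilinear_map K M N P f" and "m \<in> carrier M" "n \<in> carrier N"
  shows "tensor_lift K M N P f (pure_tensor K M N m n) = f m n"
proof -
  note f' = bilinear_mapD[OF f]
  interpret M: vectorspace K M by (fact f')
  let ?S = "carrier M \<times> carrier N"
  have "free_gen K ?S (m, n) \<in> carrier (free_space K ?S)"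
    by (rule free_gen_closed[OF M.ring_axioms]) (simp add: assms)
  then have "tensor_lift K M N P f (pure_tensor K M N m n) =
      linear_extension K ?S P (\<lambda>s. f (fst s) (snd s)) (free_gen K ?S (m, n))"
    unfolding pure_tensor_def by (rule tensor_lift_coset[OF f])
  also have "\<dots> = f (fst (m, n)) (snd (m, n))"
    by (rule linear_extension_gen[OF f'(3)]) (auto intro: linear_map_closed[OF f'(4)] simp: assms)
  finally show ?thesis
    by simp
qed

text \<open>
  The tool for recognising a map defined by a lift as a composition \<open>L\<close> of known linear maps:
  bilinearity of \<open>f\<close> follows from the linearity of \<open>L\<close>, so only the values on pure tensors have
  to be compared.
\<close>

lemma tensor_lift_unique:
  assumes M: "vectorspace K M" and N: "vectorspace K N"
    and L: "linear_map K (M \<boxtimes>\<^bsub>K\<^esub> N) P L"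
    and f: "\<And>m n. m \<in> carrier M \<Longrightarrow> n \<in> carrier N \<Longrightarrow> f m n = L (pure_tensor K M N m n)"
    and x: "x \<in> carrier (M \<boxtimes>\<^bsub>K\<^esub> N)"
  shows "tensor_lift K M N P f x = L x"
proof -
  note b = bilinear_mapD[OF pure_tensor_bilinear[OF M N]]
  have "bilinear_map K M N P f"
    using M N linear_map_target[OF L]
    by (rule bilinear_mapI; intro linear_map_cong[OF linear_map_compose[OF b(4) L]]
        linear_map_cong[OF linear_map_compose[OF b(5) L]]) (simp_all add: f)
  then show ?thesis
    by (intro linear_map_eq_on_pure_tensors[OF tensor_lift_linear L M N x])
      (simp_all add: tensor_lift_pure f)
qed

text \<open>
  A trilinear map \<open>f\<close> induces a bilinear map out of \<open>(A \<otimes> B) \<times> C\<close>.  Linearity in \<open>c\<close> holds at pure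
  tensors by hypothesis and is inherited by sums.  Both reassociation maps are lifts of maps of
  this kind.
\<close>

lemma tensor_lift_bilinear:
  assumes A: "vectorspace K A" and B: "vectorspace K B" and C: "vectorspace K C"
    and fixed: "\<And>c. c \<in> carrier C \<Longrightarrow> bilinear_map K A B P (\<lambda>a b. f a b c)"
    and linear: "\<And>a b. a \<in> carrier A \<Longrightarrow> b \<in> carrier B \<Longrightarrow> linear_map K C P (f a b)"
  shows "bilinear_map K (A \<boxtimes>\<^bsub>K\<^esub> B) C P (\<lambda>x c. tensor_lift K A B P (\<lambda>a b. f a b c) x)"
proof (rule bilinear_mapI[OF tensor_vectorspace[OF A B] C])
  interpret C: vectorspace K C by (fact C)
  show "vectorspace K P"
    using bilinear_mapD(3)[OF fixed[OF C.zero_closed]] .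
  fix c assume "c \<in> carrier C"
  then show "linear_map K (A \<boxtimes>\<^bsub>K\<^esub> B) P (\<lambda>x. tensor_lift K A B P (\<lambda>a b. f a b c) x)"
    by (intro tensor_lift_linear fixed)
next
  fix x assume "x \<in> carrier (A \<boxtimes>\<^bsub>K\<^esub> B)"
  with A B show "linear_map K C P (\<lambda>c. tensor_lift K A B P (\<lambda>a b. f a b c) x)"
  proof (induction rule: tensor_induct)
    case (pure a b)
    show ?case
      by (rule linear_map_cong[OF linear[OF pure]]) (rule tensor_lift_pure[OF fixed pure])
  next
    case (add x y)
    show ?case
      by (rule linear_map_cong[OF linear_map_sum[OF add.IH]])
        (rule linear_map_add[OF tensor_lift_linear[OF fixed] add.hyps])
  qed
qed

section \<open>Functoriality, associativity and units\<close>

lemma tensor_map_bilinear: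
  assumes f: "linear_map K M M' f" and g: "linear_map K N N' g"
  shows "bilinear_map K M N (M' \<boxtimes>\<^bsub>K\<^esub> N') (\<lambda>m n. pure_tensor K M' N' (f m) (g n))"
proof -
  note M' = linear_map_target[OF f] and N' = linear_map_target[OF g]
  from bilinear_map_compose[OF pure_tensor_bilinear[OF M' N'] f g
      linear_map_id[OF tensor_vectorspace[OF M' N']]]
  show ?thesis
    by simp
qed

lemma tensor_map_linear:
  assumes "linear_map K M M' f" "linear_map K N N' g"
  shows "linear_map K (M \<boxtimes>\<^bsub>K\<^esub> N) (M' \<boxtimes>\<^bsub>K\<^esub> N') (tensor_map K M N M' N' f g)"
  unfolding tensor_map_def by (rule tensor_lift_linear[OF tensor_map_bilinear[OF assms]])

lemma tensor_map_pure:
  assumes "linear_map K M M' f" "linear_map K N N' g" and "m \<in> carrier M" "n \<in> carrier N"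
  shows "tensor_map K M N M' N' f g (pure_tensor K M N m n) = pure_tensor K M' N' (f m) (g n)"
  unfolding tensor_map_def
  by (rule tensor_lift_pure[OF tensor_map_bilinear[OF assms(1,2)] assms(3,4)])

lemma tensor_map_cong:
  assumes f: "linear_map K M M' f" and g: "linear_map K N N' g"
    and eq: "\<And>m. m \<in> carrier M \<Longrightarrow> f' m = f m" "\<And>n. n \<in> carrier N \<Longrightarrow> g' n = g n"
    and x: "x \<in> carrier (M \<boxtimes>\<^bsub>K\<^esub> N)"
  shows "tensor_map K M N M' N' f' g' x = tensor_map K M N M' N' f g x"
  unfolding tensor_map_def[of K M N M' N' f' g']
  by (rule tensor_lift_unique[OF linear_map_source[OF f] linear_map_source[OF g]
        tensor_map_linear[OF f g] _ x])
    (simp add: eq tensor_map_pure[OF f g])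

lemma tensor_map_compose:
  assumes f: "linear_map K M M' f" and g: "linear_map K N N' g"
    and f': "linear_map K M' M'' f'" and g': "linear_map K N' N'' g'"
    and x: "x \<in> carrier (M \<boxtimes>\<^bsub>K\<^esub> N)"
  shows "tensor_map K M' N' M'' N'' f' g' (tensor_map K M N M' N' f g x) =
    tensor_map K M N M'' N'' (\<lambda>m. f' (f m)) (\<lambda>n. g' (g n)) x"
proof (rule linear_map_eq_on_pure_tensors[OF _ _ linear_map_source[OF f] linear_map_source[OF g] x])
  note f'f = linear_map_compose[OF f f'] and g'g = linear_map_compose[OF g g']
  show "linear_map K (M \<boxtimes>\<^bsub>K\<^esub> N) (M'' \<boxtimes>\<^bsub>K\<^esub> N'')
      (\<lambda>x. tensor_map K M' N' M'' N'' f' g' (tensor_map K M N M' N' f g x))"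
    by (rule linear_map_compose[OF tensor_map_linear[OF f g] tensor_map_linear[OF f' g']])
  show "linear_map K (M \<boxtimes>\<^bsub>K\<^esub> N) (M'' \<boxtimes>\<^bsub>K\<^esub> N'')
      (tensor_map K M N M'' N'' (\<lambda>m. f' (f m)) (\<lambda>n. g' (g n)))"
    by (rule tensor_map_linear[OF f'f g'g])
  fix m n assume "m \<in> carrier M" "n \<in> carrier N"
  then show "tensor_map K M' N' M'' N'' f' g' (tensor_map K M N M' N' f g (pure_tensor K M N m n)) =
      tensor_map K M N M'' N'' (\<lambda>m. f' (f m)) (\<lambda>n. g' (g n)) (pure_tensor K M N m n)"
    by (simp add: tensor_map_pure[OF f g] tensor_map_pure[OF f' g'] tensor_map_pure[OF f'f g'g]
        linear_map_closed[OF f] linear_map_closed[OF g])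
qed

lemma linear_map_eq_on_triple_tensors:
  assumes A: "vectorspace K A" and B: "vectorspace K B" and C: "vectorspace K C"
    and f: "linear_map K (A \<boxtimes>\<^bsub>K\<^esub> B \<boxtimes>\<^bsub>K\<^esub> C) P f" and g: "linear_map K (A \<boxtimes>\<^bsub>K\<^esub> B \<boxtimes>\<^bsub>K\<^esub> C) P g"
    and x: "x \<in> carrier (A \<boxtimes>\<^bsub>K\<^esub> B \<boxtimes>\<^bsub>K\<^esub> C)"
    and eq: "\<And>a b c. a \<in> carrier A \<Longrightarrow> b \<in> carrier B \<Longrightarrow> c \<in> carrier C \<Longrightarrow>
      f (pure_tensor K (A \<boxtimes>\<^bsub>K\<^esub> B) C (pure_tensor K A B a b) c) =
      g (pure_tensor K (A \<boxtimes>\<^bsub>K\<^esub> B) C (pure_tensor K A B a b) c)"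
  shows "f x = g x"
proof (rule linear_map_eq_on_pure_tensors[OF f g tensor_vectorspace[OF A B] C x])
  fix y c assume y: "y \<in> carrier (A \<boxtimes>\<^bsub>K\<^esub> B)" and c: "c \<in> carrier C"
  note p = bilinear_mapD(4)[OF pure_tensor_bilinear[OF tensor_vectorspace[OF A B] C] c]
  show "f (pure_tensor K (A \<boxtimes>\<^bsub>K\<^esub> B) C y c) = g (pure_tensor K (A \<boxtimes>\<^bsub>K\<^esub> B) C y c)"
    by (rule linear_map_eq_on_pure_tensors[OF linear_map_compose[OF p f]
          linear_map_compose[OF p g] A B y]) (rule eq[OF _ _ c])
qed

lemma assoc_right_bilinear:
  assumes A: "vectorspace K A" and B: "vectorspace K B" and C: "vectorspace K C"
  shows "bilinear_map K (A \<boxtimes>\<^bsub>K\<^esub> B) C (A \<boxtimes>\<^bsub>K\<^esub> (B \<boxtimes>\<^bsub>K\<^esub> C))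
      (\<lambda>x c. tensor_lift K A B (A \<boxtimes>\<^bsub>K\<^esub> (B \<boxtimes>\<^bsub>K\<^esub> C))
        (\<lambda>a b. pure_tensor K A (B \<boxtimes>\<^bsub>K\<^esub> C) a (pure_tensor K B C b c)) x)"
    and "c \<in> carrier C \<Longrightarrow> bilinear_map K A B (A \<boxtimes>\<^bsub>K\<^esub> (B \<boxtimes>\<^bsub>K\<^esub> C))
        (\<lambda>a b. pure_tensor K A (B \<boxtimes>\<^bsub>K\<^esub> C) a (pure_tensor K B C b c))"
proof -
  note BC = tensor_vectorspace[OF B C]
  note A_BC = tensor_vectorspace[OF A BC]
  have fixed: "bilinear_map K A B (A \<boxtimes>\<^bsub>K\<^esub> (B \<boxtimes>\<^bsub>K\<^esub> C))
        (\<lambda>a b. pure_tensor K A (B \<boxtimes>\<^bsub>K\<^esub> C) a (pure_tensor K B C b c))" if "c \<in> carrier C" for c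
    using bilinear_map_compose[OF pure_tensor_bilinear[OF A BC] linear_map_id[OF A]
        bilinear_mapD(4)[OF pure_tensor_bilinear[OF B C] that] linear_map_id[OF A_BC]]
    by simp
  show "bilinear_map K (A \<boxtimes>\<^bsub>K\<^esub> B) C (A \<boxtimes>\<^bsub>K\<^esub> (B \<boxtimes>\<^bsub>K\<^esub> C))
      (\<lambda>x c. tensor_lift K A B (A \<boxtimes>\<^bsub>K\<^esub> (B \<boxtimes>\<^bsub>K\<^esub> C))
        (\<lambda>a b. pure_tensor K A (B \<boxtimes>\<^bsub>K\<^esub> C) a (pure_tensor K B C b c)) x)"
  proof (rule tensor_lift_bilinear[OF A B C fixed])
    fix a b assume "a \<in> carrier A" "b \<in> carrier B"
    then show "linear_map K C (A \<boxtimes>\<^bsub>K\<^esub> (B \<boxtimes>\<^bsub>K\<^esub> C))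
        (\<lambda>c. pure_tensor K A (B \<boxtimes>\<^bsub>K\<^esub> C) a (pure_tensor K B C b c))"
      by (rule_tac linear_map_compose[OF bilinear_mapD(5)[OF pure_tensor_bilinear[OF B C]]
            bilinear_mapD(5)[OF pure_tensor_bilinear[OF A BC]]])
  qed
  show "c \<in> carrier C \<Longrightarrow> bilinear_map K A B (A \<boxtimes>\<^bsub>K\<^esub> (B \<boxtimes>\<^bsub>K\<^esub> C))
        (\<lambda>a b. pure_tensor K A (B \<boxtimes>\<^bsub>K\<^esub> C) a (pure_tensor K B C b c))"
    by (rule fixed)
qed

lemma assoc_right_linear:
  assumes "vectorspace K A" "vectorspace K B" "vectorspace K C"
  shows "linear_map K (A \<boxtimes>\<^bsub>K\<^esub> B \<boxtimes>\<^bsub>K\<^esub> C) (A \<boxtimes>\<^bsub>K\<^esub> (B \<boxtimes>\<^bsub>K\<^esub> C)) (assoc_right K A B C)"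
  unfolding assoc_right_def by (rule tensor_lift_linear[OF assoc_right_bilinear(1)[OF assms]])

lemma assoc_right_pure:
  assumes V: "vectorspace K A" "vectorspace K B" "vectorspace K C"
    and a: "a \<in> carrier A" and b: "b \<in> carrier B" and c: "c \<in> carrier C"
  shows "assoc_right K A B C (pure_tensor K (A \<boxtimes>\<^bsub>K\<^esub> B) C (pure_tensor K A B a b) c) =
    pure_tensor K A (B \<boxtimes>\<^bsub>K\<^esub> C) a (pure_tensor K B C b c)"
  unfolding assoc_right_def
  by (subst tensor_lift_pure[OF assoc_right_bilinear(1)[OF V] pure_tensor_closed[OF V(1,2) a b] c],
      rule tensor_lift_pure[OF assoc_right_bilinear(2)[OF V c] a b])

lemma assoc_left_bilinear:
  assumes A: "vectorspace K A" and B: "vectorspace K B" and C: "vectorspace K C"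
  shows "bilinear_map K A (B \<boxtimes>\<^bsub>K\<^esub> C) (A \<boxtimes>\<^bsub>K\<^esub> B \<boxtimes>\<^bsub>K\<^esub> C)
      (\<lambda>a x. tensor_lift K B C (A \<boxtimes>\<^bsub>K\<^esub> B \<boxtimes>\<^bsub>K\<^esub> C)
        (\<lambda>b c. pure_tensor K (A \<boxtimes>\<^bsub>K\<^esub> B) C (pure_tensor K A B a b) c) x)"
    and "a \<in> carrier A \<Longrightarrow> bilinear_map K B C (A \<boxtimes>\<^bsub>K\<^esub> B \<boxtimes>\<^bsub>K\<^esub> C)
        (\<lambda>b c. pure_tensor K (A \<boxtimes>\<^bsub>K\<^esub> B) C (pure_tensor K A B a b) c)"
proof -
  note AB = tensor_vectorspace[OF A B]
  note AB_C = tensor_vectorspace[OF AB C]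
  have fixed: "bilinear_map K B C (A \<boxtimes>\<^bsub>K\<^esub> B \<boxtimes>\<^bsub>K\<^esub> C)
        (\<lambda>b c. pure_tensor K (A \<boxtimes>\<^bsub>K\<^esub> B) C (pure_tensor K A B a b) c)" if "a \<in> carrier A" for a
    using bilinear_map_compose[OF pure_tensor_bilinear[OF AB C]
        bilinear_mapD(5)[OF pure_tensor_bilinear[OF A B] that] linear_map_id[OF C]
        linear_map_id[OF AB_C]]
    by simp
  show "bilinear_map K A (B \<boxtimes>\<^bsub>K\<^esub> C) (A \<boxtimes>\<^bsub>K\<^esub> B \<boxtimes>\<^bsub>K\<^esub> C)
      (\<lambda>a x. tensor_lift K B C (A \<boxtimes>\<^bsub>K\<^esub> B \<boxtimes>\<^bsub>K\<^esub> C)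
        (\<lambda>b c. pure_tensor K (A \<boxtimes>\<^bsub>K\<^esub> B) C (pure_tensor K A B a b) c) x)"
  proof (rule bilinear_map_flip[OF tensor_lift_bilinear[OF B C A fixed]])
    fix b c assume "b \<in> carrier B" "c \<in> carrier C"
    then show "linear_map K A (A \<boxtimes>\<^bsub>K\<^esub> B \<boxtimes>\<^bsub>K\<^esub> C)
        (\<lambda>a. pure_tensor K (A \<boxtimes>\<^bsub>K\<^esub> B) C (pure_tensor K A B a b) c)"
      by (rule_tac linear_map_compose[OF bilinear_mapD(4)[OF pure_tensor_bilinear[OF A B]]
            bilinear_mapD(4)[OF pure_tensor_bilinear[OF AB C]]])
  qed
  show "a \<in> carrier A \<Longrightarrow> bilinear_map K B C (A \<boxtimes>\<^bsub>K\<^esub> B \<boxtimes>\<^bsub>K\<^esub> C)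
        (\<lambda>b c. pure_tensor K (A \<boxtimes>\<^bsub>K\<^esub> B) C (pure_tensor K A B a b) c)"
    by (rule fixed)
qed

lemma assoc_left_linear:
  assumes "vectorspace K A" "vectorspace K B" "vectorspace K C"
  shows "linear_map K (A \<boxtimes>\<^bsub>K\<^esub> (B \<boxtimes>\<^bsub>K\<^esub> C)) (A \<boxtimes>\<^bsub>K\<^esub> B \<boxtimes>\<^bsub>K\<^esub> C) (assoc_left K A B C)"
  unfolding assoc_left_def by (rule tensor_lift_linear[OF assoc_left_bilinear(1)[OF assms]])

lemma assoc_left_pure:
  assumes V: "vectorspace K A" "vectorspace K B" "vectorspace K C"
    and a: "a \<in> carrier A" and b: "b \<in> carrier B" and c: "c \<in> carrier C"
  shows "assoc_left K A B C (pure_tensor K A (B \<boxtimes>\<^bsub>K\<^esub> C) a (pure_tensor K B C b c)) =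
    pure_tensor K (A \<boxtimes>\<^bsub>K\<^esub> B) C (pure_tensor K A B a b) c"
  unfolding assoc_left_def
  by (subst tensor_lift_pure[OF assoc_left_bilinear(1)[OF V] a pure_tensor_closed[OF V(2,3) b c]],
      rule tensor_lift_pure[OF assoc_left_bilinear(2)[OF V a] b c])

lemma assoc_left_assoc_right:
  assumes V: "vectorspace K A" "vectorspace K B" "vectorspace K C"
    and x: "x \<in> carrier (A \<boxtimes>\<^bsub>K\<^esub> B \<boxtimes>\<^bsub>K\<^esub> C)"
  shows "assoc_left K A B C (assoc_right K A B C x) = x"
proof -
  have "assoc_left K A B C (assoc_right K A B C x) = id x"
    by (rule linear_map_eq_on_triple_tensors[OF V
          linear_map_compose[OF assoc_right_linear[OF V] assoc_left_linear[OF V]]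
          linear_map_id[OF tensor_vectorspace[OF tensor_vectorspace[OF V(1,2)] V(3)]] x])
      (simp add: assoc_right_pure[OF V] assoc_left_pure[OF V])
  then show ?thesis
    by simp
qed

lemma assoc_right_natural:
  assumes f: "linear_map K A A' f" and g: "linear_map K B B' g" and h: "linear_map K C C' h"
    and x: "x \<in> carrier (A \<boxtimes>\<^bsub>K\<^esub> B \<boxtimes>\<^bsub>K\<^esub> C)"
  shows "assoc_right K A' B' C'
      (tensor_map K (A \<boxtimes>\<^bsub>K\<^esub> B) C (A' \<boxtimes>\<^bsub>K\<^esub> B') C' (tensor_map K A B A' B' f g) h x) =
    tensor_map K A (B \<boxtimes>\<^bsub>K\<^esub> C) A' (B' \<boxtimes>\<^bsub>K\<^esub> C') f (tensor_map K B C B' C' g h)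
      (assoc_right K A B C x)"
proof -
  note V = linear_map_source[OF f] linear_map_source[OF g] linear_map_source[OF h]
  note V' = linear_map_target[OF f] linear_map_target[OF g] linear_map_target[OF h]
  note fg = tensor_map_linear[OF f g] and gh = tensor_map_linear[OF g h]
  show ?thesis
    by (rule linear_map_eq_on_triple_tensors[OF V
          linear_map_compose[OF tensor_map_linear[OF fg h] assoc_right_linear[OF V']]
          linear_map_compose[OF assoc_right_linear[OF V] tensor_map_linear[OF f gh]] x])
      (simp add: assoc_right_pure[OF V] assoc_right_pure[OF V'] tensor_map_pure[OF fg h]
        tensor_map_pure[OF f gh] tensor_map_pure[OF f g] tensor_map_pure[OF g h]
        pure_tensor_closed V linear_map_closed[OF f] linear_map_closed[OF g] linear_map_closed[OF h])
qed

lemma scalar_space_vectorspace: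
  assumes "field K"
  shows "vectorspace K (scalar_space K)"
proof -
  interpret K: field K by fact
  have "\<exists>y\<in>carrier K. x \<oplus>\<^bsub>K\<^esub> y = \<zero>\<^bsub>K\<^esub>" if "x \<in> carrier K" for x
    using that by (intro bexI[of _ "\<ominus>\<^bsub>K\<^esub> x"]) (simp_all add: K.r_neg)
  then have "module K (scalar_space K)"
    by (intro module_criteria K.cring_axioms)
      (simp_all add: scalar_space_def K.l_distr K.r_distr K.m_assoc K.a_ac)
  then show ?thesis
    by (simp add: vectorspace_def K.field_axioms)
qed

lemma smult_bilinear:
  assumes M: "vectorspace K M"
  shows "bilinear_map K (scalar_space K) M M (\<lambda>a m. a \<odot>\<^bsub>M\<^esub> m)"
proof -
  interpret M: vectorspace K M by fact
  note S = scalar_space_vectorspace[OF M.field_axioms]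
  show ?thesis
    by (rule bilinear_mapI[OF S M M]; rule linear_mapI)
      (simp_all add: S M, simp_all add: scalar_space_def M.smult_l_distr M.smult_r_distr
        M.smult_assoc1 M.m_comm flip: M.smult_assoc1)
qed

lemma unit_left_linear:
  "vectorspace K M \<Longrightarrow> linear_map K (scalar_space K \<boxtimes>\<^bsub>K\<^esub> M) M (unit_left K M)"
  unfolding unit_left_def by (rule tensor_lift_linear[OF smult_bilinear])

lemma unit_left_pure:
  "vectorspace K M \<Longrightarrow> a \<in> carrier (scalar_space K) \<Longrightarrow> m \<in> carrier M \<Longrightarrow>
    unit_left K M (pure_tensor K (scalar_space K) M a m) = a \<odot>\<^bsub>M\<^esub> m"
  unfolding unit_left_def by (rule tensor_lift_pure[OF smult_bilinear])

lemma unit_right_linear: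
  "vectorspace K M \<Longrightarrow> linear_map K (M \<boxtimes>\<^bsub>K\<^esub> scalar_space K) M (unit_right K M)"
  unfolding unit_right_def by (rule tensor_lift_linear[OF bilinear_map_flip[OF smult_bilinear]])

lemma unit_right_pure:
  "vectorspace K M \<Longrightarrow> m \<in> carrier M \<Longrightarrow> a \<in> carrier (scalar_space K) \<Longrightarrow>
    unit_right K M (pure_tensor K M (scalar_space K) m a) = a \<odot>\<^bsub>M\<^esub> m"
  unfolding unit_right_def by (rule tensor_lift_pure[OF bilinear_map_flip[OF smult_bilinear]])

lemma unit_left_natural:
  assumes f: "linear_map K M N f" and x: "x \<in> carrier (scalar_space K \<boxtimes>\<^bsub>K\<^esub> M)"
  shows "unit_left K N (tensor_map K (scalar_space K) M (scalar_space K) N id f x) =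
    f (unit_left K M x)"
proof -
  note V = linear_map_source[OF f] linear_map_target[OF f]
  interpret M: vectorspace K M by (rule V)
  note S = scalar_space_vectorspace[OF M.field_axioms]
  note idf = tensor_map_linear[OF linear_map_id[OF S] f]
  show ?thesis
  proof (rule linear_map_eq_on_pure_tensors[OF linear_map_compose[OF idf unit_left_linear[OF V(2)]]
        linear_map_compose[OF unit_left_linear[OF V(1)] f] S V(1) x])
    fix a m assume a: "a \<in> carrier (scalar_space K)" and m: "m \<in> carrier M"
    from a have "a \<in> carrier K"
      by (simp add: scalar_space_def)
    then show "unit_left K N (tensor_map K (scalar_space K) M (scalar_space K) N id f
        (pure_tensor K (scalar_space K) M a m)) =
      f (unit_left K M (pure_tensor K (scalar_space K) M a m))"
      using a m by (simp add: tensor_map_pure[OF linear_map_id[OF S] f] unit_left_pure V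
          linear_map_closed[OF f] linear_map_smult[OF f])
  qed
qed

lemma unit_right_natural:
  assumes f: "linear_map K M N f" and x: "x \<in> carrier (M \<boxtimes>\<^bsub>K\<^esub> scalar_space K)"
  shows "unit_right K N (tensor_map K M (scalar_space K) N (scalar_space K) f id x) =
    f (unit_right K M x)"
proof -
  note V = linear_map_source[OF f] linear_map_target[OF f]
  interpret M: vectorspace K M by (rule V)
  note S = scalar_space_vectorspace[OF M.field_axioms]
  note fid = tensor_map_linear[OF f linear_map_id[OF S]]
  show ?thesis
  proof (rule linear_map_eq_on_pure_tensors[OF linear_map_compose[OF fid unit_right_linear[OF V(2)]]
        linear_map_compose[OF unit_right_linear[OF V(1)] f] V(1) S x])
    fix m a assume m: "m \<in> carrier M" and a: "a \<in> carrier (scalar_space K)"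
    from a have "a \<in> carrier K"
      by (simp add: scalar_space_def)
    then show "unit_right K N (tensor_map K M (scalar_space K) N (scalar_space K) f id
        (pure_tensor K M (scalar_space K) m a)) =
      f (unit_right K M (pure_tensor K M (scalar_space K) m a))"
      using a m by (simp add: tensor_map_pure[OF f linear_map_id[OF S]] unit_right_pure V
          linear_map_closed[OF f] linear_map_smult[OF f])
  qed
qed

section \<open>Convolution of maps out of a coalgebra\<close>

text \<open>
  The map \<open>y \<mapsto> f y\<^sub>(\<^sub>1\<^sub>) \<otimes> g y\<^sub>(\<^sub>2\<^sub>)\<close>: the convolution product, with values in the tensor
  product of the two targets.  Written \<open>f * g\<close> below.
\<close>

definition convolution ::
  "('k, 'r) ring_scheme \<Rightarrow> ('k, 'v, 'z) coalgebra_scheme \<Rightarrow> ('k, 'a, 'x) module_scheme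
    \<Rightarrow> ('k, 'b, 'y) module_scheme \<Rightarrow> ('v \<Rightarrow> 'a) \<Rightarrow> ('v \<Rightarrow> 'b) \<Rightarrow> 'v \<Rightarrow> ('a \<times> 'b \<Rightarrow> 'k) set" where
  "convolution K Y A B f g y = tensor_map K Y Y A B f g (\<Delta>\<^bsub>Y\<^esub> y)"

lemmas convolution_abs = convolution_def [abs_def]

context coalgebra
begin

lemma convolution_linear:
  assumes "linear_map K C A f" "linear_map K C B g"
  shows "linear_map K C (A \<boxtimes>\<^bsub>K\<^esub> B) (convolution K C A B f g)"
  unfolding convolution_def by (rule linear_map_compose[OF comult_linear tensor_map_linear[OF assms]])

lemma convolution_cong:
  assumes "linear_map K C A f" "linear_map K C B g"
    and "\<And>c. c \<in> carrier C \<Longrightarrow> f' c = f c" "\<And>c. c \<in> carrier C \<Longrightarrow> g' c = g c"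
    and "c \<in> carrier C"
  shows "convolution K C A B f' g' c = convolution K C A B f g c"
  unfolding convolution_def
  by (rule tensor_map_cong[OF assms(1-4) linear_map_closed[OF comult_linear assms(5)]])

lemma tensor_map_convolution:
  assumes "linear_map K C A f" "linear_map K C B g"
    and "linear_map K A A' a" "linear_map K B B' b" and "c \<in> carrier C"
  shows "tensor_map K A B A' B' a b (convolution K C A B f g c) =
    convolution K C A' B' (\<lambda>c. a (f c)) (\<lambda>c. b (g c)) c"
  unfolding convolution_def
  by (rule tensor_map_compose[OF assms(1-4) linear_map_closed[OF comult_linear assms(5)]])

text \<open>
  \<open>(f * g) * h\<close> is \<open>(f \<otimes> g) \<otimes> h\<close> after the left-hand iterated comultiplication.  Naturality moves
  the reassociation past \<open>f\<close>, \<open>g\<close>, \<open>h\<close>, and coassociativity then turns the left-hand iteration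
  into the right-hand one.
\<close>

lemma assoc_right_convolution:
  assumes f: "linear_map K C F f" and g: "linear_map K C G g" and h: "linear_map K C H h"
    and c: "c \<in> carrier C"
  shows "assoc_right K F G H (convolution K C (F \<boxtimes>\<^bsub>K\<^esub> G) H (convolution K C F G f g) h c) =
    convolution K C F (G \<boxtimes>\<^bsub>K\<^esub> H) f (convolution K C G H g h) c"
proof -
  note id = linear_map_id[OF linear_map_source[OF f]]
  note fg = tensor_map_linear[OF f g] and gh = tensor_map_linear[OF g h]
  note dc = linear_map_closed[OF comult_linear c]
  have split: "convolution K C (F \<boxtimes>\<^bsub>K\<^esub> G) H (convolution K C F G f g) h c =
      tensor_map K (C \<boxtimes>\<^bsub>K\<^esub> C) C (F \<boxtimes>\<^bsub>K\<^esub> G) H (tensor_map K C C F G f g) h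
        (tensor_map K C C (C \<boxtimes>\<^bsub>K\<^esub> C) C \<Delta> id (\<Delta> c))"
    using tensor_map_compose[OF comult_linear id fg h dc] by (simp only: convolution_abs id_apply)
  have natural: "assoc_right K F G H \<dots> =
      tensor_map K C (C \<boxtimes>\<^bsub>K\<^esub> C) F (G \<boxtimes>\<^bsub>K\<^esub> H) f (tensor_map K C C G H g h)
        (assoc_right K C C C (tensor_map K C C (C \<boxtimes>\<^bsub>K\<^esub> C) C \<Delta> id (\<Delta> c)))"
    by (rule assoc_right_natural[OF f g h
          linear_map_closed[OF tensor_map_linear[OF comult_linear id] dc]])
  have coassoc: "assoc_right K C C C (tensor_map K C C (C \<boxtimes>\<^bsub>K\<^esub> C) C \<Delta> id (\<Delta> c)) =
      tensor_map K C C C (C \<boxtimes>\<^bsub>K\<^esub> C) id \<Delta> (\<Delta> c)"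
    using comult_coassociative c by (simp add: coassociative_def)
  have join: "tensor_map K C (C \<boxtimes>\<^bsub>K\<^esub> C) F (G \<boxtimes>\<^bsub>K\<^esub> H) f (tensor_map K C C G H g h) \<dots> =
      convolution K C F (G \<boxtimes>\<^bsub>K\<^esub> H) f (convolution K C G H g h) c"
    using tensor_map_compose[OF id comult_linear f gh dc] by (simp only: convolution_abs id_apply)
  show ?thesis
    unfolding split natural coassoc join ..
qed

lemma assoc_left_convolution:
  assumes f: "linear_map K C F f" and g: "linear_map K C G g" and h: "linear_map K C H h"
    and c: "c \<in> carrier C"
  shows "assoc_left K F G H (convolution K C F (G \<boxtimes>\<^bsub>K\<^esub> H) f (convolution K C G H g h) c) =
    convolution K C (F \<boxtimes>\<^bsub>K\<^esub> G) H (convolution K C F G f g) h c"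
proof -
  note V = linear_map_target[OF f] linear_map_target[OF g] linear_map_target[OF h]
  show ?thesis
    unfolding assoc_right_convolution[OF assms, symmetric]
    by (rule assoc_left_assoc_right[OF V
          linear_map_closed[OF convolution_linear[OF convolution_linear[OF f g] h] c]])
qed

lemma counit_linear: "linear_map K C (scalar_space K) \<epsilon>"
  using counit by (simp add: is_counit_def)

lemma unit_left_convolution_counit:
  assumes f: "linear_map K C F f" and c: "c \<in> carrier C"
  shows "unit_left K F (convolution K C (scalar_space K) F \<epsilon> f c) = f c"
proof -
  note id = linear_map_id[OF linear_map_source[OF f]]
    and ids = linear_map_id[OF linear_map_target[OF counit_linear]]
  note dc = linear_map_closed[OF comult_linear c]
  have split: "convolution K C (scalar_space K) F \<epsilon> f c =
      tensor_map K (scalar_space K) C (scalar_space K) F id f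
        (tensor_map K C C (scalar_space K) C \<epsilon> id (\<Delta> c))"
    using tensor_map_compose[OF counit_linear id ids f dc] by (simp only: convolution_abs id_apply)
  have "unit_left K F \<dots> =
      f (unit_left K C (tensor_map K C C (scalar_space K) C \<epsilon> id (\<Delta> c)))"
    by (rule unit_left_natural[OF f linear_map_closed[OF tensor_map_linear[OF counit_linear id] dc]])
  also have "\<dots> = f c"
    using counit c by (simp add: is_counit_def)
  finally show ?thesis
    unfolding split .
qed

lemma unit_right_convolution_counit:
  assumes f: "linear_map K C F f" and c: "c \<in> carrier C"
  shows "unit_right K F (convolution K C F (scalar_space K) f \<epsilon> c) = f c"
proof -
  note id = linear_map_id[OF linear_map_source[OF f]]
    and ids = linear_map_id[OF linear_map_target[OF counit_linear]]
  note dc = linear_map_closed[OF comult_linear c]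
  have split: "convolution K C F (scalar_space K) f \<epsilon> c =
      tensor_map K C (scalar_space K) F (scalar_space K) f id
        (tensor_map K C C C (scalar_space K) id \<epsilon> (\<Delta> c))"
    using tensor_map_compose[OF id counit_linear f ids dc] by (simp only: convolution_abs id_apply)
  have "unit_right K F \<dots> =
      f (unit_right K C (tensor_map K C C C (scalar_space K) id \<epsilon> (\<Delta> c)))"
    by (rule unit_right_natural[OF f linear_map_closed[OF tensor_map_linear[OF id counit_linear] dc]])
  also have "\<dots> = f c"
    using counit c by (simp add: is_counit_def)
  finally show ?thesis
    unfolding split .
qed

end

section \<open>The twisted tensor product\<close>

text \<open>
  Read as a composition of linear maps, \<open>p\<^sub>C\<close> is \<open>(id \<otimes> e) \<circ> (\<Delta>\<^sub>C \<otimes> id)\<close> up to the canonical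
  isomorphisms.  In this shape it can be applied to a convolution factor by factor.
\<close>

lemma proj_left_eq:
  assumes C: "coalgebra K C" and D: "vectorspace K D"
    and e: "linear_map K (C \<boxtimes>\<^bsub>K\<^esub> D) (scalar_space K) e" and x: "x \<in> carrier (C \<boxtimes>\<^bsub>K\<^esub> D)"
  shows "proj_left K C D e x =
    unit_right K C (tensor_map K C (C \<boxtimes>\<^bsub>K\<^esub> D) C (scalar_space K) id e
      (assoc_right K C C D (tensor_map K C D (C \<boxtimes>\<^bsub>K\<^esub> C) D \<Delta>\<^bsub>C\<^esub> id x)))"
proof -
  interpret C: coalgebra K C by (fact C)
  have VC: "vectorspace K C" by unfold_locales
  note idC = linear_map_id[OF VC] and idD = linear_map_id[OF D]
  let ?R = "\<lambda>z. unit_right K C (tensor_map K C (C \<boxtimes>\<^bsub>K\<^esub> D) C (scalar_space K) id e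
      (assoc_right K C C D z))"
  have R: "linear_map K (C \<boxtimes>\<^bsub>K\<^esub> C \<boxtimes>\<^bsub>K\<^esub> D) C ?R"
    by (rule linear_map_compose[OF linear_map_compose[OF assoc_right_linear[OF VC VC D]
            tensor_map_linear[OF idC e]] unit_right_linear[OF VC]])
  note CC = tensor_vectorspace[OF VC VC]
  show ?thesis
    unfolding proj_left_def
  proof (rule tensor_lift_unique[OF VC D
        linear_map_compose[OF tensor_map_linear[OF C.comult_linear idD] R] _ x])
    fix c d assume c: "c \<in> carrier C" and d: "d \<in> carrier D"
    note dc = linear_map_closed[OF C.comult_linear c]
    have "tensor_lift K C C C (\<lambda>c1 c2. e (pure_tensor K C D c2 d) \<odot>\<^bsub>C\<^esub> c1) (\<Delta>\<^bsub>C\<^esub> c) =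
        ?R (pure_tensor K (C \<boxtimes>\<^bsub>K\<^esub> C) D (\<Delta>\<^bsub>C\<^esub> c) d)"
    proof (rule tensor_lift_unique[OF VC VC
          linear_map_compose[OF bilinear_mapD(4)[OF pure_tensor_bilinear[OF CC D] d] R] _ dc])
      fix c1 c2 assume c12: "c1 \<in> carrier C" "c2 \<in> carrier C"
      note p = pure_tensor_closed[OF VC D c12(2) d]
      show "e (pure_tensor K C D c2 d) \<odot>\<^bsub>C\<^esub> c1 =
          ?R (pure_tensor K (C \<boxtimes>\<^bsub>K\<^esub> C) D (pure_tensor K C C c1 c2) d)"
        by (simp add: assoc_right_pure[OF VC VC D c12 d] tensor_map_pure[OF idC e c12(1) p]
            unit_right_pure[OF VC c12(1) linear_map_closed[OF e p]])
    qed
    then show "tensor_lift K C C C (\<lambda>c1 c2. e (pure_tensor K C D c2 d) \<odot>\<^bsub>C\<^esub> c1) (\<Delta>\<^bsub>C\<^esub> c) =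
        ?R (tensor_map K C D (C \<boxtimes>\<^bsub>K\<^esub> C) D \<Delta>\<^bsub>C\<^esub> id (pure_tensor K C D c d))"
      by (simp add: tensor_map_pure[OF C.comult_linear idD c d])
  qed
qed

lemma proj_right_eq:
  assumes C: "vectorspace K C" and D: "coalgebra K D"
    and e: "linear_map K (C \<boxtimes>\<^bsub>K\<^esub> D) (scalar_space K) e" and x: "x \<in> carrier (C \<boxtimes>\<^bsub>K\<^esub> D)"
  shows "proj_right K C D e x =
    unit_left K D (tensor_map K (C \<boxtimes>\<^bsub>K\<^esub> D) D (scalar_space K) D e id
      (assoc_left K C D D (tensor_map K C D C (D \<boxtimes>\<^bsub>K\<^esub> D) id \<Delta>\<^bsub>D\<^esub> x)))"
proof -
  interpret D: coalgebra K D by (fact D)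
  have VD: "vectorspace K D" by unfold_locales
  note idC = linear_map_id[OF C] and idD = linear_map_id[OF VD]
  let ?R = "\<lambda>z. unit_left K D (tensor_map K (C \<boxtimes>\<^bsub>K\<^esub> D) D (scalar_space K) D e id
      (assoc_left K C D D z))"
  have R: "linear_map K (C \<boxtimes>\<^bsub>K\<^esub> (D \<boxtimes>\<^bsub>K\<^esub> D)) D ?R"
    by (rule linear_map_compose[OF linear_map_compose[OF assoc_left_linear[OF C VD VD]
            tensor_map_linear[OF e idD]] unit_left_linear[OF VD]])
  note DD = tensor_vectorspace[OF VD VD]
  show ?thesis
    unfolding proj_right_def
  proof (rule tensor_lift_unique[OF C VD
        linear_map_compose[OF tensor_map_linear[OF idC D.comult_linear] R] _ x])
    fix c d assume c: "c \<in> carrier C" and d: "d \<in> carrier D"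
    note dd = linear_map_closed[OF D.comult_linear d]
    have "tensor_lift K D D D (\<lambda>d1 d2. e (pure_tensor K C D c d1) \<odot>\<^bsub>D\<^esub> d2) (\<Delta>\<^bsub>D\<^esub> d) =
        ?R (pure_tensor K C (D \<boxtimes>\<^bsub>K\<^esub> D) c (\<Delta>\<^bsub>D\<^esub> d))"
    proof (rule tensor_lift_unique[OF VD VD
          linear_map_compose[OF bilinear_mapD(5)[OF pure_tensor_bilinear[OF C DD] c] R] _ dd])
      fix d1 d2 assume d12: "d1 \<in> carrier D" "d2 \<in> carrier D"
      note p = pure_tensor_closed[OF C VD c d12(1)]
      show "e (pure_tensor K C D c d1) \<odot>\<^bsub>D\<^esub> d2 =
          ?R (pure_tensor K C (D \<boxtimes>\<^bsub>K\<^esub> D) c (pure_tensor K D D d1 d2))"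
        by (simp add: assoc_left_pure[OF C VD VD c d12] tensor_map_pure[OF e idD p d12(2)]
            unit_left_pure[OF VD linear_map_closed[OF e p] d12(2)])
    qed
    then show "tensor_lift K D D D (\<lambda>d1 d2. e (pure_tensor K C D c d1) \<odot>\<^bsub>D\<^esub> d2) (\<Delta>\<^bsub>D\<^esub> d) =
        ?R (tensor_map K C D C (D \<boxtimes>\<^bsub>K\<^esub> D) id \<Delta>\<^bsub>D\<^esub> (pure_tensor K C D c d))"
      by (simp add: tensor_map_pure[OF idC D.comult_linear c d])
  qed
qed

lemma coalgebra_homD:
  assumes "f \<in> coalgebra_hom K Y C"
  shows "linear_map K Y C f" and "y \<in> carrier Y \<Longrightarrow> \<Delta>\<^bsub>C\<^esub> (f y) = convolution K Y C C f f y"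
    and "y \<in> carrier Y \<Longrightarrow> \<epsilon>\<^bsub>C\<^esub> (f y) = \<epsilon>\<^bsub>Y\<^esub> y"
  using assms by (simp_all add: coalgebra_hom_def convolution_def)

text \<open>
  Write \<open>w = u * v\<close>.  Up to reassociation, each expression below arises from the previous one by one of the
  maps whose composition is \<open>\<Delta>\<^sub>\<Psi>\<close>, and the passage through \<open>\<Psi>\<close> uses the compatibility of \<open>u\<close>
  and \<open>v\<close> with the twist:
  \<open>u * v\<close>, then \<open>(u * u) * (v * v)\<close>, which is \<open>u * ((u * v) * v)\<close>, then \<open>u * ((v * u) * v)\<close>, which is
  \<open>(u * v) * (u * v) = w * w\<close>.
\<close>

lemma twisted_comult_convolution:
  assumes Y: "coalgebra K Y" and C: "coalgebra K C" and D: "coalgebra K D"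
    and \<Psi>: "linear_map K (C \<boxtimes>\<^bsub>K\<^esub> D) (D \<boxtimes>\<^bsub>K\<^esub> C) \<Psi>"
    and u: "u \<in> coalgebra_hom K Y C" and v: "v \<in> coalgebra_hom K Y D"
    and twist: "\<And>y. y \<in> carrier Y \<Longrightarrow> \<Psi> (convolution K Y C D u v y) = convolution K Y D C v u y"
    and y: "y \<in> carrier Y"
  defines "w \<equiv> convolution K Y C D u v"
  shows "twisted_comult K C D \<Psi> (w y) = convolution K Y (C \<boxtimes>\<^bsub>K\<^esub> D) (C \<boxtimes>\<^bsub>K\<^esub> D) w w y"
proof -
  interpret Y: coalgebra K Y by (fact Y)
  interpret C: coalgebra K C by (fact C)
  interpret D: coalgebra K D by (fact D)
  have V: "vectorspace K C" "vectorspace K D" by unfold_locales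
  note u' = coalgebra_homD[OF u] and v' = coalgebra_homD[OF v]
  note idC = linear_map_id[OF V(1)] and idD = linear_map_id[OF V(2)]
  note uu = Y.convolution_linear[OF u'(1) u'(1)] and uv = Y.convolution_linear[OF u'(1) v'(1)]
    and vu = Y.convolution_linear[OF v'(1) u'(1)] and vv = Y.convolution_linear[OF v'(1) v'(1)]
  note u_vv = Y.convolution_linear[OF u'(1) vv] and uv_v = Y.convolution_linear[OF uv v'(1)]
    and vu_v = Y.convolution_linear[OF vu v'(1)] and v_uv = Y.convolution_linear[OF v'(1) uv]
  have step1: "tensor_map K C D (C \<boxtimes>\<^bsub>K\<^esub> C) (D \<boxtimes>\<^bsub>K\<^esub> D) \<Delta>\<^bsub>C\<^esub> \<Delta>\<^bsub>D\<^esub> (w y) =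
      convolution K Y (C \<boxtimes>\<^bsub>K\<^esub> C) (D \<boxtimes>\<^bsub>K\<^esub> D) (convolution K Y C C u u) (convolution K Y D D v v) y"
    unfolding w_def
    by (subst Y.tensor_map_convolution[OF u'(1) v'(1) C.comult_linear D.comult_linear y])
      (rule Y.convolution_cong[OF uu vv u'(2) v'(2) y])
  have step2: "assoc_right K C C (D \<boxtimes>\<^bsub>K\<^esub> D) \<dots> =
      convolution K Y C (C \<boxtimes>\<^bsub>K\<^esub> (D \<boxtimes>\<^bsub>K\<^esub> D)) u
        (convolution K Y C (D \<boxtimes>\<^bsub>K\<^esub> D) u (convolution K Y D D v v)) y"
    by (rule Y.assoc_right_convolution[OF u'(1) u'(1) vv y])
  have step3: "tensor_map K C (C \<boxtimes>\<^bsub>K\<^esub> (D \<boxtimes>\<^bsub>K\<^esub> D)) C (C \<boxtimes>\<^bsub>K\<^esub> D \<boxtimes>\<^bsub>K\<^esub> D) id (assoc_left K C D D) \<dots> =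
      convolution K Y C (C \<boxtimes>\<^bsub>K\<^esub> D \<boxtimes>\<^bsub>K\<^esub> D) u
        (convolution K Y (C \<boxtimes>\<^bsub>K\<^esub> D) D (convolution K Y C D u v) v) y"
    by (subst Y.tensor_map_convolution[OF u'(1) u_vv idC assoc_left_linear[OF V(1,2,2)] y])
      (rule Y.convolution_cong[OF u'(1) uv_v _ Y.assoc_left_convolution[OF u'(1) v'(1) v'(1)] y],
        simp)
  have inner: "tensor_map K (C \<boxtimes>\<^bsub>K\<^esub> D) D (D \<boxtimes>\<^bsub>K\<^esub> C) D \<Psi> id
        (convolution K Y (C \<boxtimes>\<^bsub>K\<^esub> D) D (convolution K Y C D u v) v z) =
      convolution K Y (D \<boxtimes>\<^bsub>K\<^esub> C) D (convolution K Y D C v u) v z" if z: "z \<in> carrier Y" for z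
    by (subst Y.tensor_map_convolution[OF uv v'(1) \<Psi> idD z])
      (rule Y.convolution_cong[OF vu v'(1) twist _ z], simp_all)
  have step4: "tensor_map K C (C \<boxtimes>\<^bsub>K\<^esub> D \<boxtimes>\<^bsub>K\<^esub> D) C (D \<boxtimes>\<^bsub>K\<^esub> C \<boxtimes>\<^bsub>K\<^esub> D) id
        (tensor_map K (C \<boxtimes>\<^bsub>K\<^esub> D) D (D \<boxtimes>\<^bsub>K\<^esub> C) D \<Psi> id)
        (convolution K Y C (C \<boxtimes>\<^bsub>K\<^esub> D \<boxtimes>\<^bsub>K\<^esub> D) u
          (convolution K Y (C \<boxtimes>\<^bsub>K\<^esub> D) D (convolution K Y C D u v) v) y) =
      convolution K Y C (D \<boxtimes>\<^bsub>K\<^esub> C \<boxtimes>\<^bsub>K\<^esub> D) u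
        (convolution K Y (D \<boxtimes>\<^bsub>K\<^esub> C) D (convolution K Y D C v u) v) y"
    by (subst Y.tensor_map_convolution[OF u'(1) uv_v idC tensor_map_linear[OF \<Psi> idD] y])
      (rule Y.convolution_cong[OF u'(1) vu_v _ inner y], simp)
  have step5: "tensor_map K C (D \<boxtimes>\<^bsub>K\<^esub> C \<boxtimes>\<^bsub>K\<^esub> D) C (D \<boxtimes>\<^bsub>K\<^esub> (C \<boxtimes>\<^bsub>K\<^esub> D)) id (assoc_right K D C D) \<dots> =
      convolution K Y C (D \<boxtimes>\<^bsub>K\<^esub> (C \<boxtimes>\<^bsub>K\<^esub> D)) u
        (convolution K Y D (C \<boxtimes>\<^bsub>K\<^esub> D) v (convolution K Y C D u v)) y"
    by (subst Y.tensor_map_convolution[OF u'(1) vu_v idC assoc_right_linear[OF V(2,1,2)] y])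
      (rule Y.convolution_cong[OF u'(1) v_uv _ Y.assoc_right_convolution[OF v'(1) u'(1) v'(1)] y],
        simp)
  have step6: "assoc_left K C D (C \<boxtimes>\<^bsub>K\<^esub> D) \<dots> = convolution K Y (C \<boxtimes>\<^bsub>K\<^esub> D) (C \<boxtimes>\<^bsub>K\<^esub> D) w w y"
    unfolding w_def by (rule Y.assoc_left_convolution[OF u'(1) v'(1) uv y])
  show ?thesis
    unfolding twisted_comult_def comp_apply step1 step2 step3 step4 step5 step6 ..
qed

lemma twisted_tensor_simps:
  shows carrier_twisted_tensor: "carrier (twisted_tensor K C D \<Psi> e) = carrier (C \<boxtimes>\<^bsub>K\<^esub> D)"
    and comult_twisted_tensor: "\<Delta>\<^bsub>twisted_tensor K C D \<Psi> e\<^esub> = twisted_comult K C D \<Psi>"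
    and counit_twisted_tensor: "\<epsilon>\<^bsub>twisted_tensor K C D \<Psi> e\<^esub> = e"
    and add_twisted_tensor: "add (twisted_tensor K C D \<Psi> e) = add (C \<boxtimes>\<^bsub>K\<^esub> D)"
    and zero_twisted_tensor: "zero (twisted_tensor K C D \<Psi> e) = zero (C \<boxtimes>\<^bsub>K\<^esub> D)"
    and smult_twisted_tensor: "smult (twisted_tensor K C D \<Psi> e) = smult (C \<boxtimes>\<^bsub>K\<^esub> D)"
  by (simp_all add: twisted_tensor_def module.defs coalgebra.defs)

lemma twisted_tensor_vectorspace:
  assumes C: "vectorspace K C" and D: "vectorspace K D"
  shows "vectorspace K (twisted_tensor K C D \<Psi> e)"
proof -
  interpret V: vectorspace K "C \<boxtimes>\<^bsub>K\<^esub> D" by (rule tensor_vectorspace[OF C D])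
  have "\<exists>y\<in>carrier (C \<boxtimes>\<^bsub>K\<^esub> D). x \<oplus>\<^bsub>C \<boxtimes>\<^bsub>K\<^esub> D\<^esub> y = \<zero>\<^bsub>C \<boxtimes>\<^bsub>K\<^esub> D\<^esub>"
    if "x \<in> carrier (C \<boxtimes>\<^bsub>K\<^esub> D)" for x
    using that by (intro bexI[of _ "\<ominus>\<^bsub>C \<boxtimes>\<^bsub>K\<^esub> D\<^esub> x"]) (simp_all add: V.M.r_neg)
  then have "module K (twisted_tensor K C D \<Psi> e)"
    by (intro module_criteria V.cring_axioms)
      (simp_all add: twisted_tensor_simps V.smult_l_distr V.smult_r_distr V.smult_assoc1 V.M.a_ac)
  then show ?thesis
    by (simp add: vectorspace_def V.field_axioms)
qed

text \<open>
  The tensor square of the twisted coalgebra is literally that of the vector space \<open>C \<otimes> D\<close>, since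
  the construction of a tensor product reads off only the vector space part of a record.
\<close>

lemma tensor_map_twisted_tensor:
  "tensor_map K M N (twisted_tensor K C D \<Psi> e) (twisted_tensor K C D \<Psi> e) f g =
    tensor_map K M N (C \<boxtimes>\<^bsub>K\<^esub> D) (C \<boxtimes>\<^bsub>K\<^esub> D) f g"
  by (simp add: tensor_map_def pure_tensor_def tensor_space_def tensor_null_def
      tensor_relations_def twisted_tensor_simps)

theorem theorem3p8:
  fixes K :: "('k, 'r) ring_scheme"
    and C :: "('k, 'c, 'x) coalgebra_scheme"
    and D :: "('k, 'd, 'y) coalgebra_scheme"
    and Y :: "('k, 'v, 'z) coalgebra_scheme"
    and \<Psi> :: "('c \<times> 'd \<Rightarrow> 'k) set \<Rightarrow> ('d \<times> 'c \<Rightarrow> 'k) set"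
    and \<epsilon>\<^sub>\<Psi> :: "('c \<times> 'd \<Rightarrow> 'k) set \<Rightarrow> 'k"
    and u\<^sub>C :: "'v \<Rightarrow> 'c"
    and u\<^sub>D :: "'v \<Rightarrow> 'd"
  assumes "field K"
    and "coalgebra K C"
    and "coalgebra K D"
    and "linear_map K (C \<boxtimes>\<^bsub>K\<^esub> D) (D \<boxtimes>\<^bsub>K\<^esub> C) \<Psi>"
    and "twist_coassociative K C D \<Psi>"
    and "is_counit K (C \<boxtimes>\<^bsub>K\<^esub> D) (twisted_comult K C D \<Psi>) \<epsilon>\<^sub>\<Psi>"
    and "coalgebra K Y"
    and "u\<^sub>C \<in> coalgebra_hom K Y C"
    and "u\<^sub>D \<in> coalgebra_hom K Y D"
    and "\<forall>y\<in>carrier Y. tensor_map K Y Y D C u\<^sub>D u\<^sub>C (\<Delta>\<^bsub>Y\<^esub> y)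
           = \<Psi> (tensor_map K Y Y C D u\<^sub>C u\<^sub>D (\<Delta>\<^bsub>Y\<^esub> y))"
    and "\<forall>y\<in>carrier Y. \<epsilon>\<^sub>\<Psi> (tensor_map K Y Y C D u\<^sub>C u\<^sub>D (\<Delta>\<^bsub>Y\<^esub> y)) = \<epsilon>\<^bsub>Y\<^esub> y"
  shows "\<exists>\<omega>\<in>coalgebra_hom K Y (twisted_tensor K C D \<Psi> \<epsilon>\<^sub>\<Psi>). \<forall>y\<in>carrier Y.
           u\<^sub>C y = proj_left K C D \<epsilon>\<^sub>\<Psi> (\<omega> y) \<and> u\<^sub>D y = proj_right K C D \<epsilon>\<^sub>\<Psi> (\<omega> y)"
proof (rule bexI)
  interpret C: coalgebra K C by (fact assms)
  interpret D: coalgebra K D by (fact assms)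
  interpret Y: coalgebra K Y by (fact assms)
  have V: "vectorspace K C" "vectorspace K D" by unfold_locales
  note uC = coalgebra_homD[OF assms(8)] and uD = coalgebra_homD[OF assms(9)]
  note idC = linear_map_id[OF V(1)] and idD = linear_map_id[OF V(2)]
  let ?w = "convolution K Y C D u\<^sub>C u\<^sub>D"
  let ?k = "scalar_space K"
  have w: "linear_map K Y (C \<boxtimes>\<^bsub>K\<^esub> D) ?w"
    by (rule Y.convolution_linear[OF uC(1) uD(1)])
  have e: "linear_map K (C \<boxtimes>\<^bsub>K\<^esub> D) ?k \<epsilon>\<^sub>\<Psi>"
    using assms(6) by (simp add: is_counit_def)
  have twist: "\<Psi> (?w y) = convolution K Y D C u\<^sub>D u\<^sub>C y" if "y \<in> carrier Y" for y
    using assms(10) that by (simp add: convolution_def)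
  have counit: "\<epsilon>\<^sub>\<Psi> (?w y) = \<epsilon>\<^bsub>Y\<^esub> y" if "y \<in> carrier Y" for y
    using assms(11) that by (simp add: convolution_def)
  show "?w \<in> coalgebra_hom K Y (twisted_tensor K C D \<Psi> \<epsilon>\<^sub>\<Psi>)"
    unfolding coalgebra_hom_def
  proof (intro CollectI conjI ballI)
    show "linear_map K Y (twisted_tensor K C D \<Psi> \<epsilon>\<^sub>\<Psi>) ?w"
      by (rule linear_mapI[OF linear_map_source[OF w] twisted_tensor_vectorspace[OF V]])
        (simp_all add: twisted_tensor_simps linear_mapD(3-5)[OF w])
    fix y assume y: "y \<in> carrier Y"
    show "\<Delta>\<^bsub>twisted_tensor K C D \<Psi> \<epsilon>\<^sub>\<Psi>\<^esub> (?w y) =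
        tensor_map K Y Y (twisted_tensor K C D \<Psi> \<epsilon>\<^sub>\<Psi>) (twisted_tensor K C D \<Psi> \<epsilon>\<^sub>\<Psi>) ?w ?w (\<Delta>\<^bsub>Y\<^esub> y)"
      unfolding tensor_map_twisted_tensor comult_twisted_tensor convolution_def[symmetric]
      by (rule twisted_comult_convolution[OF assms(7,2,3,4,8,9) twist y])
    show "\<epsilon>\<^bsub>twisted_tensor K C D \<Psi> \<epsilon>\<^sub>\<Psi>\<^esub> (?w y) = \<epsilon>\<^bsub>Y\<^esub> y"
      unfolding counit_twisted_tensor by (rule counit[OF y])
  qed
  show "\<forall>y\<in>carrier Y. u\<^sub>C y = proj_left K C D \<epsilon>\<^sub>\<Psi> (?w y) \<and> u\<^sub>D y = proj_right K C D \<epsilon>\<^sub>\<Psi> (?w y)"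
  proof (intro ballI conjI)
    fix y assume y: "y \<in> carrier Y"
    note wy = linear_map_closed[OF w y]
    note uu = Y.convolution_linear[OF uC(1) uC(1)] and vv = Y.convolution_linear[OF uD(1) uD(1)]
    have a: "tensor_map K C D (C \<boxtimes>\<^bsub>K\<^esub> C) D \<Delta>\<^bsub>C\<^esub> id (?w y) =
        convolution K Y (C \<boxtimes>\<^bsub>K\<^esub> C) D (convolution K Y C C u\<^sub>C u\<^sub>C) u\<^sub>D y"
      by (subst Y.tensor_map_convolution[OF uC(1) uD(1) C.comult_linear idD y])
        (rule Y.convolution_cong[OF uu uD(1) uC(2) _ y], simp_all)
    have b: "assoc_right K C C D \<dots> = convolution K Y C (C \<boxtimes>\<^bsub>K\<^esub> D) u\<^sub>C ?w y"
      by (rule Y.assoc_right_convolution[OF uC(1) uC(1) uD(1) y])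
    have c: "tensor_map K C (C \<boxtimes>\<^bsub>K\<^esub> D) C ?k id \<epsilon>\<^sub>\<Psi> \<dots> = convolution K Y C ?k u\<^sub>C \<epsilon>\<^bsub>Y\<^esub> y"
      by (subst Y.tensor_map_convolution[OF uC(1) w idC e y])
        (rule Y.convolution_cong[OF uC(1) Y.counit_linear _ counit y], simp)
    show "u\<^sub>C y = proj_left K C D \<epsilon>\<^sub>\<Psi> (?w y)"
      unfolding proj_left_eq[OF assms(2) V(2) e wy] a b c
      by (rule Y.unit_right_convolution_counit[OF uC(1) y, symmetric])
    have a: "tensor_map K C D C (D \<boxtimes>\<^bsub>K\<^esub> D) id \<Delta>\<^bsub>D\<^esub> (?w y) =
        convolution K Y C (D \<boxtimes>\<^bsub>K\<^esub> D) u\<^sub>C (convolution K Y D D u\<^sub>D u\<^sub>D) y"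
      by (subst Y.tensor_map_convolution[OF uC(1) uD(1) idC D.comult_linear y])
        (rule Y.convolution_cong[OF uC(1) vv _ uD(2) y], simp)
    have b: "assoc_left K C D D \<dots> = convolution K Y (C \<boxtimes>\<^bsub>K\<^esub> D) D ?w u\<^sub>D y"
      by (rule Y.assoc_left_convolution[OF uC(1) uD(1) uD(1) y])
    have c: "tensor_map K (C \<boxtimes>\<^bsub>K\<^esub> D) D ?k D \<epsilon>\<^sub>\<Psi> id \<dots> = convolution K Y ?k D \<epsilon>\<^bsub>Y\<^esub> u\<^sub>D y"
      by (subst Y.tensor_map_convolution[OF w uD(1) e idD y])
        (rule Y.convolution_cong[OF Y.counit_linear uD(1) counit _ y], simp_all)
    show "u\<^sub>D y = proj_right K C D \<epsilon>\<^sub>\<Psi> (?w y)"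
      unfolding proj_right_eq[OF V(1) assms(3) e wy] a b c
      by (rule Y.unit_left_convolution_counit[OF uD(1) y, symmetric])
  qed
qed

end
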